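(* Let $\ell,n_c\ge1$ be integers, $\rho>0$, $\epsilon\in(0,1)$, and consider the Rician memoryless block-fading channel described in the context, with mean $\mu_H$ and variance $\sigma_H^2$. Then $$R^*(\ell,n_c,\epsilon,\rho)\ \le\ \inf_{\lambda\ge0}\ \frac{1}{\ell n_c\log 2}\Big(\lambda-\log\Big[\Pr\Big\{\sum_{k=1}^\ell S_k^1\le\lambda\Big\}-\epsilon\Big]^+\Big),$$ where $$\begin{aligned}S_k^1={}&-\log\Big(\frac{1+\sigma_H^2n_c\rho}{\sigma_H^2}\Big)-\log\Gamma(n_c)-\big(\|\mathbf W_k\|^2-\|\widetilde{\mathbf W}_k\|^2\big)+\frac{|\mu_H|^2}{\sigma_H^2}\\&-\log\int_0^\infty\frac{\exp\big(-(\rho n_c+\sigma_H^{-2})z\big)}{\big(\|\widetilde{\mathbf W}_k\|\sqrt{\rho n_cz}\big)^{n_c-1}}\,I_{n_c-1}\big(2\|\widetilde{\mathbf W}_k\|\sqrt{\rho n_cz}\big)\,I_0\big(2\sigma_H^{-2}\sqrt{z|\mu_H|^2}\big)\,dz.\end{aligned}$$ Here $\mathbf W_1,\dots,\mathbf W_\ell$ are i.i.d. $\mathcal{CN}(\mathbf 0,\mathbf I_{n_c})$ and, with $\odot$ the entrywise product and $\mathbf 0_{n},\mathbf 1_{n}$ the all-zero and all-one vectors of size $n$, $$\widetilde{\mathbf W}_k=\begin{bmatrix}\mu_H\sqrt{n_c\rho}\\ \mathbf 0_{n_c-1}\end{bmatrix}+\begin{bmatrix}\sqrt{\sigma_H^2n_c\rho+1}\\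 \mathbf 1_{n_c-1}\end{bmatrix}\odot\mathbf W_k.$$
   Context: Channel. Fix a Rician factor $\kappa\in[0,\infty)$ and put $\mu_H=\sqrt{\kappa/(1+\kappa)}$, $\sigma_H^2=(1+\kappa)^{-1}$. The channel input is $\mathbf x^\ell=[\mathbf x_1,\dots,\mathbf x_\ell]$ with $\mathbf x_k\in\mathbb C^{n_c}$, and the output is $\mathbf Y^\ell=[\mathbf Y_1,\dots,\mathbf Y_\ell]$ with $\mathbf Y_k=H_k\mathbf x_k+\mathbf W_k$, $k=1,\dots,\ell$, where $H_k\sim\mathcal{CN}(\mu_H,\sigma_H^2)$ and $\mathbf W_k\sim\mathcal{CN}(\mathbf 0,\mathbf I_{n_c})$ are all mutually independent. The realizations of $H_k$ are known neither to the encoder nor to the decoder. $\mathcal{CN}$ denotes the circularly-symmetric complex Gaussian distribution. Code. An $(\ell,n_c,M,\epsilon,\rho)$-code consists of (i) an encoder $f:\{1,\dots,M\}\to\mathbb C^{n_c\ell}$, mapping message $m$ to a codeword $\mathbf c_m=[\mathbf c_{m,1},\dots,\mathbf c_{m,\ell}]$ with $\mathbf c_{m,k}\in\mathbb C^{n_c}$ and $\|\mathbf c_{m,k}\|^2=n_c\rho$ for all $m,k$; (ii) a decoder $g:\mathbb C^{n_c\ell}\to\{1,\dots,M\}$ with average error probability $\frac1M\sum_{j=1}^M\Pr\{g(\mathbf Y^\ell)\ne j\mid \mathbf x^\ell=f(j)\}\le\epsilon$. Maximum coding rate (bits per channel use): $R^*(\ell,n_c,\epsilon,\rho)=\sup\{\frac{\log_2M}{\ell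 n_c}:\ \text{there exists an }(\ell,n_c,M,\epsilon,\rho)\text{-code}\}$. Notation: $\log$ is the natural logarithm, $[a]^+=\max\{0,a\}$, $\Gamma$ is the Gamma function, $I_\nu$ is the modified Bessel function of the first kind, $\|\cdot\|$ is the Euclidean norm. Convention: $-\log 0=+\infty$. *)

theory Defs
  imports "HOL-Probability.Probability"
begin

text \<open>
  Blocks are indexed by \<open>k < l\<close> and the entries of a vector by \<open>i < n\<close>, both counted from 0.
  A vector in \<open>\<complex>\<^sup>n\<close> is a function in \<open>space (vec_space n)\<close>, and a sequence of \<open>l\<close>
  such vectors is a function in \<open>space (block_space l n)\<close>.
\<close>

definition vec_space :: "nat \<Rightarrow> (nat \<Rightarrow> complex) measure" where
  "vec_space n = (\<Pi>\<^sub>M i\<in>{..<n}. borel)"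

definition block_space :: "nat \<Rightarrow> nat \<Rightarrow> (nat \<Rightarrow> nat \<Rightarrow> complex) measure" where
  "block_space l n = (\<Pi>\<^sub>M k\<in>{..<l}. vec_space n)"

definition vnorm :: "nat \<Rightarrow> (nat \<Rightarrow> complex) \<Rightarrow> real" where
  "vnorm n w = L2_set (\<lambda>i. cmod (w i)) {..<n}"

text \<open>
  Circularly-symmetric complex Gaussian law with mean \<open>m\<close> and variance \<open>v > 0\<close>
  (the real and imaginary parts each have variance \<open>v / 2\<close>); the law with mean \<open>0\<close> and
  identity covariance on \<open>\<complex>\<^sup>n\<close> has independent standard entries.
\<close>

definition cgauss :: "complex \<Rightarrow> real \<Rightarrow> complex measure" where
  "cgauss m v = density lborel (\<lambda>z. ennreal (exp (- (cmod (z - m))\<^sup>2 / v) / (pi * v)))"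

definition cgauss_vec :: "nat \<Rightarrow> (nat \<Rightarrow> complex) measure" where
  "cgauss_vec n = (\<Pi>\<^sub>M i\<in>{..<n}. cgauss 0 1)"

definition mu_H :: "real \<Rightarrow> real" where
  "mu_H \<kappa> = sqrt (\<kappa> / (1 + \<kappa>))"

definition sigma2_H :: "real \<Rightarrow> real" where
  "sigma2_H \<kappa> = inverse (1 + \<kappa>)"

text \<open>
  Joint law of \<open>((H\<^sub>k, W\<^sub>k))\<^sub>k\<close>, all independent, and the law of the output
  \<open>Y\<^sub>k = H\<^sub>k x\<^sub>k + W\<^sub>k\<close> for the input \<open>x\<close>. Since the input is independent of fading and noise,
  the latter is the conditional law of the output given the input \<open>x\<close>.
\<close>

definition fading_noise_law :: "real \<Rightarrow> nat \<Rightarrow> nat \<Rightarrow> (nat \<Rightarrow> complex \<times> (nat \<Rightarrow> complex)) measure" where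
  "fading_noise_law \<kappa> l n =
     (\<Pi>\<^sub>M k\<in>{..<l}. cgauss (complex_of_real (mu_H \<kappa>)) (sigma2_H \<kappa>) \<Otimes>\<^sub>M cgauss_vec n)"

definition channel_law ::
  "real \<Rightarrow> nat \<Rightarrow> nat \<Rightarrow> (nat \<Rightarrow> nat \<Rightarrow> complex) \<Rightarrow> (nat \<Rightarrow> nat \<Rightarrow> complex) measure" where
  "channel_law \<kappa> l n x =
     distr (fading_noise_law \<kappa> l n) (block_space l n)
       (\<lambda>\<omega>. \<lambda>k\<in>{..<l}. \<lambda>i\<in>{..<n}. fst (\<omega> k) * x k i + snd (\<omega> k) i)"

definition is_code ::
  "real \<Rightarrow> nat \<Rightarrow> nat \<Rightarrow> nat \<Rightarrow> real \<Rightarrow> real \<Rightarrow>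
   (nat \<Rightarrow> nat \<Rightarrow> nat \<Rightarrow> complex) \<Rightarrow> ((nat \<Rightarrow> nat \<Rightarrow> complex) \<Rightarrow> nat) \<Rightarrow> bool" where
  "is_code \<kappa> l n M \<epsilon> \<rho> f g \<longleftrightarrow>
     M \<ge> 1 \<and>
     f \<in> {1..M} \<rightarrow> space (block_space l n) \<and>
     (\<forall>m\<in>{1..M}. \<forall>k<l. (vnorm n (f m k))\<^sup>2 = real n * \<rho>) \<and>
     g \<in> block_space l n \<rightarrow>\<^sub>M count_space {1..M} \<and>
     (\<Sum>j=1..M. \<P>(y in channel_law \<kappa> l n (f j). g y \<noteq> j)) / real M \<le> \<epsilon>"

text \<open>The supremum is taken in \<^typ>\<open>ereal\<close>, where it is meaningful without a boundedness proof.\<close>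

definition max_rate :: "real \<Rightarrow> nat \<Rightarrow> nat \<Rightarrow> real \<Rightarrow> real \<Rightarrow> ereal" where
  "max_rate \<kappa> l n \<epsilon> \<rho> =
     Sup {ereal (log 2 (real M) / (real l * real n)) | M. \<exists>f g. is_code \<kappa> l n M \<epsilon> \<rho> f g}"

text \<open>
  Modified Bessel function of the first kind \<open>I\<^sub>\<nu>\<close> of integer order \<open>\<nu>\<close>. Natural-number powers
  are used so that \<open>I\<^sub>0(0) = 1\<close> (the real power \<open>0 powr 0\<close> is \<open>0\<close>); \<open>I\<^sub>0(0)\<close> occurs
  in the integrand below when \<open>\<kappa> = 0\<close>.
\<close>

definition bessel_I :: "nat \<Rightarrow> real \<Rightarrow> real" where
  "bessel_I \<nu> x = (\<Sum>m. (x / 2) ^ (2 * m + \<nu>) / (fact m * Gamma (real m + real \<nu> + 1)))"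

text \<open>Natural logarithm on \<open>[0,\<infinity>)\<close> with the convention \<open>- log 0 = \<infinity>\<close>.\<close>

definition ext_ln :: "real \<Rightarrow> ereal" where
  "ext_ln a = (if a = 0 then - \<infinity> else ereal (ln a))"

definition W_tilde :: "real \<Rightarrow> nat \<Rightarrow> real \<Rightarrow> (nat \<Rightarrow> complex) \<Rightarrow> nat \<Rightarrow> complex" where
  "W_tilde \<kappa> n \<rho> w i =
     complex_of_real (if i = 0 then mu_H \<kappa> * sqrt (real n * \<rho>) else 0)
     + complex_of_real (if i = 0 then sqrt (sigma2_H \<kappa> * real n * \<rho> + 1) else 1) * w i"

definition S1 :: "real \<Rightarrow> nat \<Rightarrow> real \<Rightarrow> (nat \<Rightarrow> complex) \<Rightarrow> real" where
  "S1 \<kappa> n \<rho> w =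
     (let \<mu> = mu_H \<kappa>; \<sigma>2 = sigma2_H \<kappa>; r = vnorm n (W_tilde \<kappa> n \<rho> w) in
      - ln ((1 + \<sigma>2 * real n * \<rho>) / \<sigma>2) - ln (Gamma (real n))
      - ((vnorm n w)\<^sup>2 - r\<^sup>2) + \<bar>\<mu>\<bar>\<^sup>2 / \<sigma>2
      - ln (LBINT z:{0..}.
              exp (- (\<rho> * real n + inverse \<sigma>2) * z) / (r * sqrt (\<rho> * real n * z)) ^ (n - 1)
              * bessel_I (n - 1) (2 * r * sqrt (\<rho> * real n * z))
              * bessel_I 0 (2 * inverse \<sigma>2 * sqrt (z * \<bar>\<mu>\<bar>\<^sup>2))))"

definition noise_law :: "nat \<Rightarrow> nat \<Rightarrow> (nat \<Rightarrow> nat \<Rightarrow> complex) measure" where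
  "noise_law l n = (\<Pi>\<^sub>M k\<in>{..<l}. cgauss_vec n)"

end

theory Submission
  imports Defs
begin

text \<open>
  Let \<open>q\<close> be the output density of a block whose input is uniform on the sphere of squared radius
  \<open>n \<rho>\<close>; it depends on the output \<open>y\<close> only through \<open>\<parallel>y\<parallel>\<close>. Every admissible block input \<open>x\<close> is
  \<open>U (\<parallel>x\<parallel> e\<^sub>0)\<close> for a unitary \<open>U\<close>, so the output law given \<open>x\<close> is the image under \<open>U\<close> of the law of
  \<open>W_tilde\<close>, while \<open>q\<close> is invariant under \<open>U\<close>; and \<open>S1\<close> is the log-likelihood ratio between the law of
  \<open>W_tilde\<close> and \<open>q\<close>. Hence a decoding region \<open>A\<close> has probability at most
  \<open>exp \<lambda> * Q(A) + P(\<Sum> S1 > \<lambda>)\<close> under its codeword, \<open>Q\<close> being the product measure with density \<open>q\<close>.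
  Summing over the disjoint decoding regions gives \<open>M (P(\<Sum> S1 \<le> \<lambda>) - \<epsilon>) \<le> exp \<lambda>\<close>.

  That \<open>q\<close> has total mass at most 1 is checked from the Bessel series: the moments of \<open>\<parallel>W\<parallel>\<^sup>2\<close> are
  rising factorials, which turn the series into exponential series. The resulting finiteness also
  shows that the integral in \<open>S1\<close> converges almost everywhere.
\<close>

subsection \<open>Finite products of probability measures\<close>

text \<open>Densities are taken relative to \<open>cgauss_vec n\<close> instead of Lebesgue measure.
  This reference law is itself unitarily invariant, so the density \<open>q\<close> only has to
  depend on the norm. The unitary varies with the block and the codeword, so each decoding region is
  pulled back to one common law. The pulled-back regions may overlap, but each keeps its mass under
  \<open>Q\<close>, and only these masses are summed. The formula for \<open>q\<close> enters
  through two facts: its total mass is at most 1, and its ratio to the law of \<open>W_tilde\<close>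
  is correct almost everywhere. The second is delicate because a divergent Bochner integral has
  value 0 and \<open>ln 0 = 0\<close>, so \<open>S1\<close> is a log-likelihood ratio only where the
  Bessel integral is finite and positive. Unitaries are composed from phases and rotations in two
  coordinates, so no change of variables involves more than two complex coordinates.\<close>

lemma distr_PiM_components:
  assumes I: "finite I" and prob: "\<And>i. i \<in> I \<Longrightarrow> prob_space (M i)"
    and f: "\<And>i. i \<in> I \<Longrightarrow> f i \<in> M i \<rightarrow>\<^sub>M N i"
  shows "distr (PiM I M) (PiM I N) (\<lambda>\<omega>. \<lambda>i\<in>I. f i (\<omega> i)) = PiM I (\<lambda>i. distr (M i) (N i) (f i))"
proof -
  \<comment> \<open>\<open>product_sigma_finite\<close> asks for a sigma-finite measure at every
    index of the type, while the hypotheses speak only of \<open>I\<close>; a point mass fills in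
    elsewhere.\<close>
  let ?T = "return (count_space UNIV) undefined"
  define M' where "M' = (\<lambda>i. if i \<in> I then M i else ?T)"
  define D where "D = (\<lambda>i. if i \<in> I then distr (M i) (N i) (f i) else ?T)"
  have probs: "prob_space (M' i)" "prob_space (D i)" for i
    by (auto simp: M'_def D_def prob prob_space_return intro!: prob_space.prob_space_distr f)
  interpret M': product_sigma_finite M'
    by (rule product_sigma_finite.intro) (rule prob_space_imp_sigma_finite[OF probs(1)])
  interpret D: product_sigma_finite D
    by (rule product_sigma_finite.intro) (rule prob_space_imp_sigma_finite[OF probs(2)])
  have M': "PiM I M = PiM I M'"
    by (intro PiM_cong) (auto simp: M'_def)
  have meas: "(\<lambda>\<omega>. \<lambda>i\<in>I. f i (\<omega> i)) \<in> PiM I M \<rightarrow>\<^sub>M PiM I N"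
    by (intro measurable_restrict measurable_compose[OF measurable_component_singleton] f)
  have "distr (PiM I M) (PiM I N) (\<lambda>\<omega>. \<lambda>i\<in>I. f i (\<omega> i)) = PiM I D"
  proof (rule D.PiM_eqI)
    show "sets (distr (PiM I M) (PiM I N) (\<lambda>\<omega>. \<lambda>i\<in>I. f i (\<omega> i))) = sets (PiM I D)"
      by (auto simp: D_def intro!: sets_PiM_cong)
    fix A assume A: "\<And>i. i \<in> I \<Longrightarrow> A i \<in> sets (D i)"
    then have A': "\<And>i. i \<in> I \<Longrightarrow> A i \<in> sets (N i)" by (auto simp: D_def)
    then have "Pi\<^sub>E I A \<in> sets (PiM I N)" by (intro sets_PiM_I_finite I) auto
    then have "emeasure (distr (PiM I M) (PiM I N) (\<lambda>\<omega>. \<lambda>i\<in>I. f i (\<omega> i))) (Pi\<^sub>E I A)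
        = emeasure (PiM I M) ((\<lambda>\<omega>. \<lambda>i\<in>I. f i (\<omega> i)) -` Pi\<^sub>E I A \<inter> space (PiM I M))"
      by (intro emeasure_distr meas)
    also have "(\<lambda>\<omega>. \<lambda>i\<in>I. f i (\<omega> i)) -` Pi\<^sub>E I A \<inter> space (PiM I M)
        = Pi\<^sub>E I (\<lambda>i. f i -` A i \<inter> space (M i))"
      by (auto simp: space_PiM PiE_iff)
    also have "emeasure (PiM I M) \<dots> = (\<Prod>i\<in>I. emeasure (M' i) (f i -` A i \<inter> space (M i)))"
      unfolding M' using f A' by (intro M'.emeasure_PiM I) (auto simp: M'_def)
    also have "\<dots> = (\<Prod>i\<in>I. emeasure (D i) (A i))"
      using f A' by (intro prod.cong) (auto simp: M'_def D_def emeasure_distr)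
    finally show "emeasure (distr (PiM I M) (PiM I N) (\<lambda>\<omega>. \<lambda>i\<in>I. f i (\<omega> i))) (Pi\<^sub>E I A)
        = (\<Prod>i\<in>I. emeasure (D i) (A i))" .
  qed fact
  also have "PiM I D = PiM I (\<lambda>i. distr (M i) (N i) (f i))"
    by (intro PiM_cong) (auto simp: D_def)
  finally show ?thesis .
qed

text \<open>Tonelli factorizes the integral of a product over a box, and boxes determine the product
  measure. Normalization of each density supplies the sigma-finiteness behind that
  uniqueness.\<close>

lemma PiM_density:
  fixes M :: "'i \<Rightarrow> 'a measure"
  assumes I: "finite I" and sf: "\<And>i. i \<in> I \<Longrightarrow> sigma_finite_measure (M i)"
    and prob: "\<And>i. i \<in> I \<Longrightarrow> prob_space (density (M i) (f i))"
    and f: "\<And>i. i \<in> I \<Longrightarrow> f i \<in> borel_measurable (M i)"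
  shows "PiM I (\<lambda>i. density (M i) (f i)) = density (PiM I M) (\<lambda>x. \<Prod>i\<in>I. f i (x i))"
proof -
  let ?T = "return (count_space UNIV) undefined"
  define M' where "M' = (\<lambda>i. if i \<in> I then M i else ?T)"
  define D where "D = (\<lambda>i. if i \<in> I then density (M i) (f i) else ?T)"
  have sfs: "sigma_finite_measure (M' i)" "sigma_finite_measure (D i)" for i
    by (auto simp: M'_def D_def sf prob prob_space_return prob_space_imp_sigma_finite)
  interpret M': product_sigma_finite M'
    by (rule product_sigma_finite.intro) (rule sfs)
  interpret D: product_sigma_finite D
    by (rule product_sigma_finite.intro) (rule sfs)
  have M': "PiM I M = PiM I M'"
    by (intro PiM_cong) (auto simp: M'_def)
  have meas: "(\<lambda>x. \<Prod>i\<in>I. f i (x i)) \<in> borel_measurable (PiM I M)"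
    using f by measurable
  have "density (PiM I M) (\<lambda>x. \<Prod>i\<in>I. f i (x i)) = PiM I D"
  proof (rule D.PiM_eqI)
    show "sets (density (PiM I M) (\<lambda>x. \<Prod>i\<in>I. f i (x i))) = sets (PiM I D)"
      by (auto simp: D_def intro!: sets_PiM_cong)
    fix A assume A: "\<And>i. i \<in> I \<Longrightarrow> A i \<in> sets (D i)"
    then have A': "\<And>i. i \<in> I \<Longrightarrow> A i \<in> sets (M i)" by (auto simp: D_def)
    then have "Pi\<^sub>E I A \<in> sets (PiM I M)" by (intro sets_PiM_I_finite I) auto
    then have "emeasure (density (PiM I M) (\<lambda>x. \<Prod>i\<in>I. f i (x i))) (Pi\<^sub>E I A)
        = (\<integral>\<^sup>+x. (\<Prod>i\<in>I. f i (x i)) * indicator (Pi\<^sub>E I A) x \<partial>PiM I M)"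
      by (intro emeasure_density meas)
    also have "\<dots> = (\<integral>\<^sup>+x. (\<Prod>i\<in>I. f i (x i) * indicator (A i) (x i)) \<partial>PiM I M)"
    proof (rule nn_integral_cong)
      fix x assume "x \<in> space (PiM I M)"
      \<comment> \<open>Membership in \<open>Pi\<^sub>E I A\<close> also fixes the values outside
        \<open>I\<close>; for extensional points only the coordinates in \<open>I\<close> remain to
        be tested.\<close>
      then have "x \<in> extensional I" by (auto simp: space_PiM PiE_def)
      then have "indicator (Pi\<^sub>E I A) x = (\<Prod>i\<in>I. indicator (A i) (x i) :: ennreal)"
        using I by (auto simp: indicator_def PiE_iff prod_zero_iff)
      then show "(\<Prod>i\<in>I. f i (x i)) * indicator (Pi\<^sub>E I A) x
          = (\<Prod>i\<in>I. f i (x i) * indicator (A i) (x i))"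
        by (simp add: prod.distrib)
    qed
    also have "\<dots> = (\<Prod>i\<in>I. \<integral>\<^sup>+x. f i x * indicator (A i) x \<partial>M' i)"
      unfolding M' using f A'
      by (intro M'.product_nn_integral_prod I) (auto simp: M'_def)
    also have "\<dots> = (\<Prod>i\<in>I. emeasure (D i) (A i))"
      using f A' by (intro prod.cong) (auto simp: M'_def D_def emeasure_density)
    finally show "emeasure (density (PiM I M) (\<lambda>x. \<Prod>i\<in>I. f i (x i))) (Pi\<^sub>E I A)
        = (\<Prod>i\<in>I. emeasure (D i) (A i))" .
  qed fact
  also have "PiM I D = PiM I (\<lambda>i. density (M i) (f i))"
    by (intro PiM_cong) (auto simp: D_def)
  finally show ?thesis ..
qed

subsection \<open>Rotation invariance and moments of complex Gaussians\<close>

text \<open>Lebesgue measure is determined by the volumes of boxes, and a complex box is the product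
  of the intervals of its real and imaginary parts.\<close>

lemma lborel_complex_eq: "(lborel :: complex measure) = distr (lborel \<Otimes>\<^sub>M lborel) borel (\<lambda>(x, y). Complex x y)"
proof (rule lborel_eqI)
  fix l u :: complex
  assume "\<And>b. b \<in> Basis \<Longrightarrow> l \<bullet> b \<le> u \<bullet> b"
  then have le: "Re l \<le> Re u" "Im l \<le> Im u"
    by (force simp: Basis_complex_def)+
  have [measurable]: "(\<lambda>(x, y). Complex x y) \<in> borel_measurable (lborel \<Otimes>\<^sub>M lborel)"
    unfolding Complex_eq by measurable
  have "(\<lambda>(x, y). Complex x y) -` box l u \<inter> space (lborel \<Otimes>\<^sub>M lborel)
      = {Re l<..<Re u} \<times> {Im l<..<Im u}"
    by (auto simp: box_def Basis_complex_def space_pair_measure)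
  then show "emeasure (distr (lborel \<Otimes>\<^sub>M lborel) borel (\<lambda>(x, y). Complex x y)) (box l u)
      = (\<Prod>b\<in>Basis. (u - l) \<bullet> b)"
    using le
    by (subst emeasure_distr)
       (auto simp: lborel.emeasure_pair_measure_Times Basis_complex_def prod_ennreal ennreal_mult)
qed simp

lemma nn_integral_lborel_complex:
  assumes [measurable]: "f \<in> borel_measurable borel"
  shows "(\<integral>\<^sup>+z. f z \<partial>lborel) = (\<integral>\<^sup>+x. \<integral>\<^sup>+y. f (Complex x y) \<partial>lborel \<partial>lborel)"
proof -
  have [measurable]: "(\<lambda>(x, y). Complex x y) \<in> borel_measurable (lborel \<Otimes>\<^sub>M lborel)"
    unfolding Complex_eq by measurable
  show ?thesis
    by (subst lborel_complex_eq)
       (simp add: nn_integral_distr lborel.nn_integral_fst[symmetric] case_prod_beta)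
qed

lemma nn_integral_lborel_affine:
  fixes f :: "'a::euclidean_space \<Rightarrow> ennreal"
  assumes "c \<noteq> 0" and [measurable]: "f \<in> borel_measurable borel"
  shows "(\<integral>\<^sup>+x. f x \<partial>lborel) = ennreal (\<bar>c\<bar> ^ DIM('a)) * (\<integral>\<^sup>+x. f (t + c *\<^sub>R x) \<partial>lborel)"
  by (subst lborel_affine[OF assms(1), of t])
     (simp add: nn_integral_density nn_integral_distr nn_integral_cmult)

text \<open>For \<open>t = cnj s\<close> the substitution is a rotation; it is a product of shears and scalings
  along the two axes.\<close>

lemma lborel_rotation:
  fixes s t :: "'a::{euclidean_space, real_normed_field}" and c :: real
  assumes c: "c \<noteq> 0" and eq: "of_real (c\<^sup>2) + s * t = 1"
    and [measurable]: "F \<in> borel_measurable (borel \<Otimes>\<^sub>M borel)"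
  shows "(\<integral>\<^sup>+a. \<integral>\<^sup>+b. F (c *\<^sub>R a - t * b, s * a + c *\<^sub>R b) \<partial>lborel \<partial>lborel)
    = (\<integral>\<^sup>+a. \<integral>\<^sup>+b. F (a, b) \<partial>lborel \<partial>lborel)"
proof -
  let ?D = "\<lambda>c. ennreal (\<bar>c\<bar> ^ DIM('a))"
  have one: "?D c * ?D (1 / c) = 1"
    using c by (simp add: ennreal_mult[symmetric] power_mult_distrib[symmetric])
  \<comment> \<open>For fixed \<open>b\<close> the first argument becomes the new \<open>a\<close>.
    The second is then \<open>(s * a + b) / c\<close>, because \<open>c\<^sup>2 + s * t = 1\<close>.
    Scaling \<open>b\<close> by \<open>1 / c\<close> with shift \<open>s * a / c\<close> removes the
    rest, and the two Jacobians cancel.\<close>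
  have *: "?D c * (\<integral>\<^sup>+a. F (c *\<^sub>R a - t * b, s * a + c *\<^sub>R b) \<partial>lborel)
      = (\<integral>\<^sup>+a. F (a, s * a /\<^sub>R c + (1 / c) *\<^sub>R b) \<partial>lborel)" for b
  proof -
    have "F (- (t * b) + c *\<^sub>R a, s * (- (t * b) + c *\<^sub>R a) /\<^sub>R c + (1 / c) *\<^sub>R b)
        = F (c *\<^sub>R a - t * b, s * a + c *\<^sub>R b)" for a
    proof -
      have "of_real c * (s * (- (t * b) + c *\<^sub>R a) /\<^sub>R c + (1 / c) *\<^sub>R b)
          = - (s * t * b) + of_real c * s * a + b"
        using c by (simp add: scaleR_conv_of_real field_simps)
      also have "s * t = 1 - of_real (c\<^sup>2)"
        using eq by (simp add: algebra_simps)
      also have "- ((1 - of_real (c\<^sup>2)) * b) + of_real c * s * a + b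
          = of_real c * (s * a + c *\<^sub>R b)"
        by (simp add: scaleR_conv_of_real algebra_simps power2_eq_square)
      finally have "s * (- (t * b) + c *\<^sub>R a) /\<^sub>R c + (1 / c) *\<^sub>R b = s * a + c *\<^sub>R b"
        using c by simp
      then show ?thesis by (simp add: algebra_simps)
    qed
    then show ?thesis
      using nn_integral_lborel_affine[OF c, of "\<lambda>a. F (a, s * a /\<^sub>R c + (1 / c) *\<^sub>R b)" "- (t * b)"]
      by simp
  qed
  have "?D c * (\<integral>\<^sup>+a. \<integral>\<^sup>+b. F (c *\<^sub>R a - t * b, s * a + c *\<^sub>R b) \<partial>lborel \<partial>lborel)
      = (\<integral>\<^sup>+b. \<integral>\<^sup>+a. F (a, s * a /\<^sub>R c + (1 / c) *\<^sub>R b) \<partial>lborel \<partial>lborel)"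
    by (subst lborel_pair.Fubini') (simp_all add: nn_integral_cmult[symmetric] * split_beta')
  also have "\<dots> = (\<integral>\<^sup>+a. \<integral>\<^sup>+b. F (a, s * a /\<^sub>R c + (1 / c) *\<^sub>R b) \<partial>lborel \<partial>lborel)"
    by (subst lborel_pair.Fubini') (simp_all add: split_beta')
  finally have "?D (1 / c) * (?D c * (\<integral>\<^sup>+a. \<integral>\<^sup>+b. F (c *\<^sub>R a - t * b, s * a + c *\<^sub>R b) \<partial>lborel \<partial>lborel))
      = (\<integral>\<^sup>+a. ?D (1 / c) * (\<integral>\<^sup>+b. F (a, s * a /\<^sub>R c + (1 / c) *\<^sub>R b) \<partial>lborel) \<partial>lborel)"
    by (simp add: nn_integral_cmult)
  also have "\<dots> = (\<integral>\<^sup>+a. \<integral>\<^sup>+b. F (a, b) \<partial>lborel \<partial>lborel)"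
    using c by (subst nn_integral_lborel_affine[where c = "1 / c", symmetric]) auto
  finally show ?thesis
    using one by (simp add: mult.assoc[symmetric] mult.commute)
qed

section \<open>Complex Gaussian laws: rotations, affine images and moments\<close>

lemma sets_cgauss [simp, measurable_cong]: "sets (cgauss m v) = sets borel"
  by (simp add: cgauss_def)

lemma space_cgauss [simp]: "space (cgauss m v) = UNIV"
  by (simp add: cgauss_def)

lemma nn_integral_cgauss:
  assumes [measurable]: "f \<in> borel_measurable borel"
  shows "(\<integral>\<^sup>+z. f z \<partial>cgauss m v)
    = (\<integral>\<^sup>+z. ennreal (exp (- (cmod (z - m))\<^sup>2 / v) / (pi * v)) * f z \<partial>lborel)"
  unfolding cgauss_def by (subst nn_integral_density) auto

lemma AE_cgauss_lborel:
  assumes "AE z in lborel. P z"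
  shows "AE z in cgauss m v. P z"
  unfolding cgauss_def using assms by (subst AE_density) auto

text \<open>In real coordinates, multiplication by \<open>w\<close> is the rotation with cosine
  \<open>Re w\<close> and sine \<open>Im w\<close>; \<open>lborel_rotation\<close> applies when the
  cosine is nonzero.\<close>

lemma lborel_complex_mult_aux:
  fixes w :: complex
  assumes w: "cmod w = 1" "Re w \<noteq> 0" and [measurable]: "f \<in> borel_measurable borel"
  shows "(\<integral>\<^sup>+z. f (w * z) \<partial>lborel) = (\<integral>\<^sup>+z. f z \<partial>lborel)"
proof -
  have [measurable]: "(\<lambda>p. f (Complex (fst p) (snd p))) \<in> borel_measurable (borel \<Otimes>\<^sub>M borel)"
    unfolding Complex_eq by measurable
  have "(Re w)\<^sup>2 + Im w * Im w = 1"
    using w by (simp add: cmod_def power2_eq_square)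
  from lborel_rotation[of "Re w" "Im w" "Im w", OF w(2), of "\<lambda>p. f (Complex (fst p) (snd p))"] this
  have "(\<integral>\<^sup>+x. \<integral>\<^sup>+y. f (Complex (Re w * x - Im w * y) (Im w * x + Re w * y)) \<partial>lborel \<partial>lborel)
      = (\<integral>\<^sup>+x. \<integral>\<^sup>+y. f (Complex x y) \<partial>lborel \<partial>lborel)"
    by simp
  moreover have "w * Complex x y = Complex (Re w * x - Im w * y) (Im w * x + Re w * y)" for x y
    by (simp add: complex_eq_iff)
  ultimately show ?thesis
    by (simp add: nn_integral_lborel_complex)
qed

lemma lborel_complex_mult:
  fixes w :: complex
  assumes w: "cmod w = 1" and [measurable]: "f \<in> borel_measurable borel"
  shows "(\<integral>\<^sup>+z. f (w * z) \<partial>lborel) = (\<integral>\<^sup>+z. f z \<partial>lborel)"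
proof (cases "Re w = 0")
  case False
  then show ?thesis using lborel_complex_mult_aux[OF w] assms(2) by blast
next
  case True
  \<comment> \<open>A purely imaginary \<open>w\<close> is applied as two multiplications by its
    square root, whose real part does not vanish.\<close>
  have v: "csqrt w * csqrt w = w" "cmod (csqrt w) = 1"
    using w by (simp_all flip: power2_eq_square)
  have "Re (csqrt w) \<noteq> 0"
    using w True by (auto simp: csqrt.sel)
  then show ?thesis
    using lborel_complex_mult_aux[of "csqrt w" "\<lambda>z. f (csqrt w * z)"]
      lborel_complex_mult_aux[of "csqrt w" f] v by (simp add: mult.assoc[symmetric])
qed

lemma cgauss_mult:
  assumes w: "cmod w = 1" and [measurable]: "f \<in> borel_measurable borel"
  shows "(\<integral>\<^sup>+z. f (w * z) \<partial>cgauss 0 v) = (\<integral>\<^sup>+z. f z \<partial>cgauss 0 v)"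
  using lborel_complex_mult[OF w, of "\<lambda>z. ennreal (exp (- (cmod z)\<^sup>2 / v) / (pi * v)) * f z"] w
  by (simp add: nn_integral_cgauss norm_mult)

lemma norm_givens:
  fixes c :: real and a b s :: complex
  assumes "c\<^sup>2 + (cmod s)\<^sup>2 = 1"
  shows "(cmod (of_real c * a - cnj s * b))\<^sup>2 + (cmod (s * a + of_real c * b))\<^sup>2 = (cmod a)\<^sup>2 + (cmod b)\<^sup>2"
proof -
  have "(cmod (of_real c * a - cnj s * b))\<^sup>2 + (cmod (s * a + of_real c * b))\<^sup>2
      = (c\<^sup>2 + (cmod s)\<^sup>2) * ((cmod a)\<^sup>2 + (cmod b)\<^sup>2)"
    unfolding cmod_power2 by (simp add: power2_eq_square algebra_simps)
  then show ?thesis using assms by simp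
qed

text \<open>The joint density depends only on \<open>|a|^2 + |b|^2\<close>, which the unitary matrix
  with rows \<open>(c, - cnj s)\<close> and \<open>(s, c)\<close> preserves. Once it is absorbed
  into \<open>G\<close>, only invariance of Lebesgue measure is left.\<close>

lemma cgauss_rotation:
  fixes c :: real and s :: complex
  assumes eq: "c\<^sup>2 + (cmod s)\<^sup>2 = 1"
    and [measurable]: "F \<in> borel_measurable (borel \<Otimes>\<^sub>M borel)"
  shows "(\<integral>\<^sup>+a. \<integral>\<^sup>+b. F (of_real c * a - cnj s * b, s * a + of_real c * b) \<partial>cgauss 0 1 \<partial>cgauss 0 1)
    = (\<integral>\<^sup>+a. \<integral>\<^sup>+b. F (a, b) \<partial>cgauss 0 1 \<partial>cgauss 0 1)"
proof -
  define G where "G = (\<lambda>p. ennreal (exp (- ((cmod (fst p))\<^sup>2 + (cmod (snd p))\<^sup>2)) / pi\<^sup>2) * F p)"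
  have [measurable]: "G \<in> borel_measurable (borel \<Otimes>\<^sub>M borel)"
    unfolding G_def by measurable
  have expand: "(\<integral>\<^sup>+a. \<integral>\<^sup>+b. H (a, b) \<partial>cgauss 0 1 \<partial>cgauss 0 1)
      = (\<integral>\<^sup>+a. \<integral>\<^sup>+b. ennreal (exp (- ((cmod a)\<^sup>2 + (cmod b)\<^sup>2)) / pi\<^sup>2) * H (a, b) \<partial>lborel \<partial>lborel)"
    if [measurable]: "H \<in> borel_measurable (borel \<Otimes>\<^sub>M borel)" for H :: "complex \<times> complex \<Rightarrow> ennreal"
  proof -
    have "(\<integral>\<^sup>+a. \<integral>\<^sup>+b. H (a, b) \<partial>cgauss 0 1 \<partial>cgauss 0 1)
      = (\<integral>\<^sup>+a. \<integral>\<^sup>+b. ennreal (exp (- (cmod a)\<^sup>2) / pi) * (ennreal (exp (- (cmod b)\<^sup>2) / pi) * H (a, b)) \<partial>lborel \<partial>lborel)"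
      by (simp add: nn_integral_cgauss nn_integral_cmult)
    also have "\<dots> = (\<integral>\<^sup>+a. \<integral>\<^sup>+b. ennreal (exp (- ((cmod a)\<^sup>2 + (cmod b)\<^sup>2)) / pi\<^sup>2) * H (a, b) \<partial>lborel \<partial>lborel)"
      by (intro nn_integral_cong)
         (simp add: mult.assoc[symmetric] ennreal_mult[symmetric] exp_add[symmetric] power2_eq_square)
    finally show ?thesis .
  qed
  note norm = norm_givens[OF eq]
  have "(\<integral>\<^sup>+a. \<integral>\<^sup>+b. F (of_real c * a - cnj s * b, s * a + of_real c * b) \<partial>cgauss 0 1 \<partial>cgauss 0 1)
      = (\<integral>\<^sup>+a. \<integral>\<^sup>+b. G (of_real c * a - cnj s * b, s * a + of_real c * b) \<partial>lborel \<partial>lborel)"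
    unfolding G_def fst_conv snd_conv norm
    using expand[of "\<lambda>p. F (of_real c * fst p - cnj s * snd p, s * fst p + of_real c * snd p)"]
    by (simp del: minus_add_distrib)
  also have "\<dots> = (\<integral>\<^sup>+a. \<integral>\<^sup>+b. G (a, b) \<partial>lborel \<partial>lborel)"
  proof (cases "c = 0")
    case False
    have "of_real (c\<^sup>2) + s * cnj s = 1"
      using eq by (simp add: complex_norm_square[symmetric] of_real_add[symmetric] del: of_real_add of_real_power)
    from lborel_rotation[OF False this, of G] show ?thesis
      by (simp add: scaleR_conv_of_real)
  next
    \<comment> \<open>The shear factorization divides by \<open>c\<close>. For \<open>c = 0\<close>
      the map is a swap of the coordinates with phases, so Fubini and
      \<open>lborel_complex_mult\<close> suffice.\<close>
    case True
    then have s: "cmod s = 1" "cmod (- cnj s) = 1"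
      using eq by (simp_all add: power2_eq_1_iff) (use norm_ge_zero[of s] in linarith)+
    have "(\<integral>\<^sup>+a. \<integral>\<^sup>+b. G (- cnj s * b, s * a) \<partial>lborel \<partial>lborel)
        = (\<integral>\<^sup>+a. \<integral>\<^sup>+b. G (b, s * a) \<partial>lborel \<partial>lborel)"
      using lborel_complex_mult[OF s(2), of "\<lambda>b. G (b, s * a)" for a] by simp
    also have "\<dots> = (\<integral>\<^sup>+b. \<integral>\<^sup>+a. G (b, s * a) \<partial>lborel \<partial>lborel)"
      by (rule lborel_pair.Fubini') simp
    also have "\<dots> = (\<integral>\<^sup>+b. \<integral>\<^sup>+a. G (b, a) \<partial>lborel \<partial>lborel)"
      using lborel_complex_mult[OF s(1), of "\<lambda>a. G (b, a)" for b] by simp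
    finally show ?thesis using True by simp
  qed
  also have "\<dots> = (\<integral>\<^sup>+a. \<integral>\<^sup>+b. F (a, b) \<partial>cgauss 0 1 \<partial>cgauss 0 1)"
    using expand[of F] by (simp add: G_def)
  finally show ?thesis .
qed

lemma nn_integral_cgauss_affine:
  assumes \<tau>: "\<tau> > 0" and [measurable]: "f \<in> borel_measurable borel"
  shows "(\<integral>\<^sup>+z. f z \<partial>cgauss m (\<tau>\<^sup>2)) = (\<integral>\<^sup>+z. f (m + of_real \<tau> * z) \<partial>cgauss 0 1)"
proof -
  have *: "ennreal (\<tau>\<^sup>2) * (ennreal (exp (- (cmod (of_real \<tau> * z))\<^sup>2 / \<tau>\<^sup>2) / (pi * \<tau>\<^sup>2)) * x)
      = ennreal (exp (- (cmod z)\<^sup>2) / pi) * x" for z x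
  proof -
    have "\<tau>\<^sup>2 * (exp (- (cmod (of_real \<tau> * z))\<^sup>2 / \<tau>\<^sup>2) / (pi * \<tau>\<^sup>2)) = exp (- (cmod z)\<^sup>2) / pi"
      using \<tau> by (simp add: norm_mult power_mult_distrib)
    then show ?thesis
      using \<tau> by (simp add: mult.assoc[symmetric] ennreal_mult[symmetric] del: times_divide_eq_right)
  qed
  have "(\<integral>\<^sup>+z. f z \<partial>cgauss m (\<tau>\<^sup>2))
      = (\<integral>\<^sup>+z. ennreal (exp (- (cmod (z - m))\<^sup>2 / \<tau>\<^sup>2) / (pi * \<tau>\<^sup>2)) * f z \<partial>lborel)"
    by (simp add: nn_integral_cgauss)
  also have "\<dots> = ennreal (\<bar>\<tau>\<bar> ^ DIM(complex)) * (\<integral>\<^sup>+z. ennreal (exp (- (cmod (m + \<tau> *\<^sub>R z - m))\<^sup>2 / \<tau>\<^sup>2) / (pi * \<tau>\<^sup>2)) * f (m + \<tau> *\<^sub>R z) \<partial>lborel)"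
    by (rule nn_integral_lborel_affine) (use \<tau> in auto)
  also have "\<dots> = (\<integral>\<^sup>+z. ennreal (exp (- (cmod z)\<^sup>2) / pi) * f (m + of_real \<tau> * z) \<partial>lborel)"
    by (subst nn_integral_cmult[symmetric]) (simp_all only: scaleR_conv_of_real add_diff_cancel_left' DIM_complex power2_abs *, measurable)
  finally show ?thesis
    by (simp add: nn_integral_cgauss)
qed

text \<open>For \<open>a > 0\<close> the rising factorials of \<open>a\<close> are the moments of a
  Gamma law with shape \<open>a\<close> and unit scale. Their binomial theorem (Vandermonde) makes
  the shapes add for independent sums, so moments of a squared norm follow from those of its
  coordinates without computing a density.\<close>

lemma pochhammer_moments_add:
  fixes f :: "'a \<Rightarrow> real" and g :: "'b \<Rightarrow> real"
  assumes [measurable]: "f \<in> borel_measurable M" "g \<in> borel_measurable N"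
    and nonneg: "\<And>x. f x \<ge> 0" "\<And>y. g y \<ge> 0" "a \<ge> 0" "b \<ge> 0"
    and f: "\<And>k. (\<integral>\<^sup>+x. ennreal (f x ^ k) \<partial>M) = ennreal (pochhammer a k)"
    and g: "\<And>k. (\<integral>\<^sup>+y. ennreal (g y ^ k) \<partial>N) = ennreal (pochhammer b k)"
  shows "(\<integral>\<^sup>+x. \<integral>\<^sup>+y. ennreal ((f x + g y) ^ m) \<partial>N \<partial>M) = ennreal (pochhammer (a + b) m)"
proof -
  have poch: "pochhammer a k \<ge> 0" "pochhammer b k \<ge> 0" for k
    using nonneg by (auto simp: pochhammer_prod intro!: prod_nonneg)
  have "(\<integral>\<^sup>+x. \<integral>\<^sup>+y. ennreal ((f x + g y) ^ m) \<partial>N \<partial>M)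
      = (\<integral>\<^sup>+x. \<integral>\<^sup>+y. (\<Sum>k\<le>m. ennreal (real (m choose k)) * ennreal (f x ^ k) * ennreal (g y ^ (m - k))) \<partial>N \<partial>M)"
    using nonneg
    by (intro nn_integral_cong) (simp add: binomial_ring sum_ennreal ennreal_mult[symmetric])
  also have "\<dots> = (\<Sum>k\<le>m. ennreal (real (m choose k)) * ennreal (pochhammer a k) * ennreal (pochhammer b (m - k)))"
    by (simp add: nn_integral_sum nn_integral_cmult nn_integral_multc f g)
  also have "\<dots> = ennreal (pochhammer (a + b) m)"
    using poch by (simp add: pochhammer_binomial_sum sum_ennreal ennreal_mult[symmetric])
  finally show ?thesis .
qed

text \<open>This is the law of the real part of a standard complex Gaussian, a normal law with
  standard deviation \<open>1 / sqrt 2\<close>. Its moment \<open>(2k)! / (4^k k!)\<close> is the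
  rising factorial of 1/2.\<close>

lemma gaussian_even_moments:
  "(\<integral>\<^sup>+x. ennreal ((x\<^sup>2) ^ k) \<partial>density lborel (\<lambda>x::real. ennreal (exp (- x\<^sup>2) / sqrt pi)))
    = ennreal (pochhammer (1 / 2) k)"
proof -
  have "normal_density 0 (1 / sqrt 2) x * (x - 0) ^ (2 * k) = exp (- x\<^sup>2) / sqrt pi * (x\<^sup>2) ^ k" for x
    by (simp add: normal_density_def power_divide power_mult)
  then have "has_bochner_integral lborel (\<lambda>x. exp (- x\<^sup>2) / sqrt pi * (x\<^sup>2) ^ k)
      (fact (2 * k) / (4 ^ k * fact k))"
    using normal_moment_even[of "1 / sqrt 2" 0 k] by (simp add: power_divide)
  then have "(\<integral>\<^sup>+x. ennreal (exp (- x\<^sup>2) / sqrt pi * (x\<^sup>2) ^ k) \<partial>lborel)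
      = ennreal (fact (2 * k) / (4 ^ k * fact k))"
    by (subst nn_integral_eq_integral) (auto simp: has_bochner_integral_iff)
  also have "fact (2 * k) / (4 ^ k * fact k) = (pochhammer (1 / 2) k :: real)"
    by (simp add: fact_double power_mult)
  finally show ?thesis
    by (simp add: nn_integral_density ennreal_mult[symmetric])
qed

text \<open>The squared modulus is a sum of two independent squares, each with parameter 1/2. The
  case \<open>k = 0\<close> is the normalization of the Gaussian law.\<close>

lemma cgauss_moments:
  "(\<integral>\<^sup>+z. ennreal (((cmod z)\<^sup>2) ^ k) \<partial>cgauss 0 1) = ennreal (pochhammer 1 k)"
proof -
  let ?M = "density lborel (\<lambda>x::real. ennreal (exp (- x\<^sup>2) / sqrt pi))"
  have "(\<integral>\<^sup>+z. ennreal (((cmod z)\<^sup>2) ^ k) \<partial>cgauss 0 1)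
      = (\<integral>\<^sup>+x. \<integral>\<^sup>+y. ennreal (exp (- (x\<^sup>2 + y\<^sup>2)) / pi) * ennreal ((x\<^sup>2 + y\<^sup>2) ^ k) \<partial>lborel \<partial>lborel)"
    by (simp add: nn_integral_cgauss nn_integral_lborel_complex cmod_power2)
  also have "\<dots> = (\<integral>\<^sup>+x. ennreal (exp (- x\<^sup>2) / sqrt pi) *
      (\<integral>\<^sup>+y. ennreal (exp (- y\<^sup>2) / sqrt pi) * ennreal ((x\<^sup>2 + y\<^sup>2) ^ k) \<partial>lborel) \<partial>lborel)"
    by (intro nn_integral_cong)
       (simp add: nn_integral_cmult[symmetric] mult.assoc[symmetric] ennreal_mult[symmetric] exp_add[symmetric])
  also have "\<dots> = (\<integral>\<^sup>+x. \<integral>\<^sup>+y. ennreal ((x\<^sup>2 + y\<^sup>2) ^ k) \<partial>?M \<partial>?M)"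
    by (simp add: nn_integral_density)
  also have "\<dots> = ennreal (pochhammer (1 / 2 + 1 / 2) k)"
    by (rule pochhammer_moments_add) (simp_all add: gaussian_even_moments)
  finally show ?thesis by simp
qed

lemma prob_space_cgauss_std: "prob_space (cgauss 0 1)"
  using cgauss_moments[of 0] by (intro prob_spaceI) simp

lemma prob_space_cgauss:
  assumes "v > 0"
  shows "prob_space (cgauss m v)"
proof (rule prob_spaceI)
  interpret prob_space "cgauss 0 1" by (rule prob_space_cgauss_std)
  show "emeasure (cgauss m v) (space (cgauss m v)) = 1"
    using nn_integral_cgauss_affine[of "sqrt v" "\<lambda>_. 1" m] assms emeasure_space_1 by simp
qed

interpretation std: product_sigma_finite "\<lambda>_::nat. cgauss 0 1"
  by (rule product_sigma_finite.intro) (rule prob_space_imp_sigma_finite[OF prob_space_cgauss_std])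

lemma sets_cgauss_vec [simp, measurable_cong]: "sets (cgauss_vec n) = sets (vec_space n)"
  unfolding cgauss_vec_def vec_space_def by (intro sets_PiM_cong) auto

lemma space_cgauss_vec [simp]: "space (cgauss_vec n) = space (vec_space n)"
  by (rule sets_eq_imp_space_eq) simp

lemma space_vec_space: "space (vec_space n) = extensional {..<n}"
  by (simp add: vec_space_def space_PiM PiE_def Pi_def)

lemma prob_space_cgauss_vec: "prob_space (cgauss_vec n)"
  unfolding cgauss_vec_def by (intro prob_space_PiM prob_space_cgauss_std)

lemma vnorm_sq: "(vnorm n y)\<^sup>2 = (\<Sum>i<n. (cmod (y i))\<^sup>2)"
  by (simp add: vnorm_def L2_set_def sum_nonneg)

lemma vnorm_nonneg [simp]: "vnorm n y \<ge> 0"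
  by (simp add: vnorm_def)

lemma measurable_vec_component:
  "i < n \<Longrightarrow> (\<lambda>y. y i) \<in> borel_measurable (vec_space n)"
  unfolding vec_space_def by measurable

lemma measurable_vnorm [measurable]: "vnorm n \<in> borel_measurable (vec_space n)"
  unfolding vnorm_def[abs_def] L2_set_def vec_space_def by measurable

text \<open>Each coordinate adds 1 to the parameter; the induction runs over arbitrary finite index
  sets so that one coordinate can be split off at a time.\<close>

lemma cgauss_vec_moments:
  "(\<integral>\<^sup>+y. ennreal (((vnorm n y)\<^sup>2) ^ m) \<partial>cgauss_vec n) = ennreal (pochhammer (real n) m)"
proof -
  have "(\<integral>\<^sup>+y. ennreal ((\<Sum>i\<in>I. (cmod (y i))\<^sup>2) ^ m) \<partial>PiM I (\<lambda>_. cgauss 0 1))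
      = ennreal (pochhammer (real (card I)) m)" if "finite I" for I :: "nat set"
    using that
  proof (induction I arbitrary: m)
    case empty
    then show ?case
      by (cases m) (auto simp: PiM_empty nn_integral_count_space_finite pochhammer_0_left)
  next
    case (insert j I)
    have "(\<integral>\<^sup>+y. ennreal ((\<Sum>i\<in>insert j I. (cmod (y i))\<^sup>2) ^ m) \<partial>PiM (insert j I) (\<lambda>_. cgauss 0 1))
        = (\<integral>\<^sup>+x. \<integral>\<^sup>+z. ennreal (((\<Sum>i\<in>I. (cmod (x i))\<^sup>2) + (cmod z)\<^sup>2) ^ m) \<partial>cgauss 0 1 \<partial>PiM I (\<lambda>_. cgauss 0 1))"
    proof (subst std.product_nn_integral_insert[OF insert.hyps])
      have "(\<Sum>i\<in>insert j I. (cmod ((x(j := z)) i))\<^sup>2) = (\<Sum>i\<in>I. (cmod (x i))\<^sup>2) + (cmod z)\<^sup>2" for x z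
      proof -
        have "(\<Sum>i\<in>I. (cmod ((x(j := z)) i))\<^sup>2) = (\<Sum>i\<in>I. (cmod (x i))\<^sup>2)"
          using insert.hyps by (intro sum.cong) auto
        then show ?thesis using insert.hyps by simp
      qed
      then show "(\<integral>\<^sup>+x. \<integral>\<^sup>+y. ennreal ((\<Sum>i\<in>insert j I. (cmod ((x(j := y)) i))\<^sup>2) ^ m) \<partial>cgauss 0 1 \<partial>PiM I (\<lambda>_. cgauss 0 1))
        = (\<integral>\<^sup>+x. \<integral>\<^sup>+z. ennreal (((\<Sum>i\<in>I. (cmod (x i))\<^sup>2) + (cmod z)\<^sup>2) ^ m) \<partial>cgauss 0 1 \<partial>PiM I (\<lambda>_. cgauss 0 1))"
        by simp
    qed measurable
    also have "\<dots> = ennreal (pochhammer (real (card I) + 1) m)"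
      by (rule pochhammer_moments_add) (simp_all add: insert.IH cgauss_moments sum_nonneg)
    finally show ?case using insert.hyps by (simp add: add.commute)
  qed
  from this[of "{..<n}"] show ?thesis
    by (simp add: cgauss_vec_def vnorm_sq)
qed

subsection \<open>Unitary maps\<close>

text \<open>Isolates the plane on which a Givens rotation acts, leaving the remaining coordinates in
  the innermost integral.\<close>

lemma nn_integral_PiM_two:
  fixes I :: "nat set"
  assumes fin: "finite I" and ij: "i \<in> I" "j \<in> I" "i \<noteq> j"
    and f: "f \<in> borel_measurable (PiM I (\<lambda>_. cgauss 0 1))"
  shows "(\<integral>\<^sup>+y. f y \<partial>PiM I (\<lambda>_. cgauss 0 1))
    = (\<integral>\<^sup>+a. \<integral>\<^sup>+b. \<integral>\<^sup>+x. f (x(j := b, i := a)) \<partial>PiM (I - {i, j}) (\<lambda>_. cgauss 0 1) \<partial>cgauss 0 1 \<partial>cgauss 0 1)"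
proof -
  define J where "J = I - {i, j}"
  have I: "I = insert i (insert j J)" and J: "finite J" "i \<notin> insert j J" "j \<notin> J" "finite (insert j J)"
    using fin ij by (auto simp: J_def)
  have [measurable]: "f \<in> borel_measurable (PiM (insert i (insert j J)) (\<lambda>_. cgauss 0 1))"
    using f I by simp
  show ?thesis
    unfolding J_def[symmetric] unfolding I
    by (subst std.product_nn_integral_insert_rev[OF J(4,2)], measurable)
       (intro nn_integral_cong, subst std.product_nn_integral_insert_rev[OF J(1,3)], measurable)
qed

text \<open>Unitarity is encoded by what the channel argument uses instead of by a matrix. The
  linearity clause has the shape of a channel output, noise plus fading times input. Invariance of
  the Gaussian law is a clause too: it is checked for phases and plane rotations and passes to
  compositions.\<close>

definition unitary_map :: "nat \<Rightarrow> ((nat \<Rightarrow> complex) \<Rightarrow> nat \<Rightarrow> complex) \<Rightarrow> bool" where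
  "unitary_map n U \<longleftrightarrow> U \<in> vec_space n \<rightarrow>\<^sub>M vec_space n \<and>
     (\<forall>y\<in>space (vec_space n). vnorm n (U y) = vnorm n y) \<and>
     (\<forall>y\<in>space (vec_space n). \<forall>z\<in>space (vec_space n). \<forall>h.
        U (\<lambda>i\<in>{..<n}. y i + h * z i) = (\<lambda>i\<in>{..<n}. U y i + h * U z i)) \<and>
     distr (cgauss_vec n) (vec_space n) U = cgauss_vec n"

lemma unitary_map_comp:
  assumes "unitary_map n U" "unitary_map n V"
  shows "unitary_map n (\<lambda>y. U (V y))"
proof -
  have [measurable]: "U \<in> vec_space n \<rightarrow>\<^sub>M vec_space n" "V \<in> vec_space n \<rightarrow>\<^sub>M vec_space n"
    using assms by (auto simp: unitary_map_def)
  have sp: "V y \<in> space (vec_space n)" if "y \<in> space (vec_space n)" for y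
    using that by (rule measurable_space[rotated]) measurable
  have "distr (cgauss_vec n) (vec_space n) (\<lambda>y. U (V y))
      = distr (distr (cgauss_vec n) (vec_space n) V) (vec_space n) U"
    by (subst distr_distr) (auto simp: comp_def)
  then show ?thesis
    using assms sp by (auto simp: unitary_map_def)
qed

lemma unitary_map_phase:
  assumes p: "cmod p = 1"
  shows "unitary_map n (\<lambda>y. \<lambda>i\<in>{..<n}. (if i = 0 then p else 1) * y i)"
proof -
  let ?p = "\<lambda>i::nat. if i = 0 then p else 1"
  have "distr (cgauss 0 1) borel (\<lambda>z. w * z) = cgauss 0 1" if "cmod w = 1" for w
  proof (rule measure_eqI)
    fix A assume "A \<in> sets (distr (cgauss 0 1) borel (\<lambda>z. w * z))"
    then have [measurable]: "A \<in> sets borel" by simp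
    show "emeasure (distr (cgauss 0 1) borel (\<lambda>z. w * z)) A = emeasure (cgauss 0 1) A"
      using cgauss_mult[OF that, of "indicator A" 1]
      by (simp add: nn_integral_indicator[symmetric] nn_integral_distr del: nn_integral_indicator)
  qed simp
  then have "distr (cgauss_vec n) (vec_space n) (\<lambda>y. \<lambda>i\<in>{..<n}. ?p i * y i) = cgauss_vec n"
    unfolding cgauss_vec_def vec_space_def using p
    by (subst distr_PiM_components) (auto intro!: PiM_cong prob_space_cgauss_std)
  moreover have "(\<lambda>y. \<lambda>i\<in>{..<n}. ?p i * y i) \<in> vec_space n \<rightarrow>\<^sub>M vec_space n"
    unfolding vec_space_def by measurable
  moreover have "vnorm n (\<lambda>i\<in>{..<n}. ?p i * y i) = vnorm n y" for y
    unfolding vnorm_def using p by (intro L2_set_cong) (auto simp: norm_mult)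
  ultimately show ?thesis
    by (auto simp: unitary_map_def fun_eq_iff algebra_simps)
qed

lemma unitary_map_givens:
  fixes c :: real and s :: complex
  assumes cs: "c\<^sup>2 + (cmod s)\<^sup>2 = 1" and ij: "i < n" "j < n" "i \<noteq> j"
  shows "unitary_map n (\<lambda>y. y(i := of_real c * y i - cnj s * y j, j := s * y i + of_real c * y j))"
    (is "unitary_map n ?G")
proof -
  have upd: "(\<lambda>y. y(i := f y, j := g y)) \<in> vec_space n \<rightarrow>\<^sub>M vec_space n"
    if "f \<in> borel_measurable (vec_space n)" "g \<in> borel_measurable (vec_space n)" for f g
    unfolding vec_space_def using that ij
    by (intro measurable_fun_upd[where J = "{..<n}"]) (auto simp: vec_space_def)
  note measurable_vec_component[OF ij(1), measurable] measurable_vec_component[OF ij(2), measurable]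
  have G [measurable]: "?G \<in> vec_space n \<rightarrow>\<^sub>M vec_space n"
    by (rule upd) measurable
  have norm: "vnorm n (?G y) = vnorm n y" for y
  proof -
    have split: "(\<Sum>k<n. h k) = h i + h j + (\<Sum>k\<in>{..<n} - {i, j}. h k)" for h :: "nat \<Rightarrow> real"
    proof -
      have "(\<Sum>k<n. h k) = h i + (\<Sum>k\<in>{..<n} - {i}. h k)"
        using ij by (intro sum.remove) auto
      also have "(\<Sum>k\<in>{..<n} - {i}. h k) = h j + (\<Sum>k\<in>{..<n} - {i} - {j}. h k)"
        using ij by (intro sum.remove) auto
      also have "{..<n} - {i} - {j} = {..<n} - {i, j}" by auto
      finally show ?thesis by simp
    qed
    note norm_givens[OF cs, of "y i" "y j"]
    moreover have "(\<Sum>k\<in>{..<n} - {i, j}. (cmod (?G y k))\<^sup>2) = (\<Sum>k\<in>{..<n} - {i, j}. (cmod (y k))\<^sup>2)"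
      by (intro sum.cong) auto
    ultimately have "(vnorm n (?G y))\<^sup>2 = (vnorm n y)\<^sup>2"
      unfolding vnorm_sq split[of "\<lambda>k. (cmod (?G y k))\<^sup>2"] split[of "\<lambda>k. (cmod (y k))\<^sup>2"]
      using ij by simp
    then show ?thesis by simp
  qed
  have lin: "?G (\<lambda>k\<in>{..<n}. y k + h * z k) = (\<lambda>k\<in>{..<n}. ?G y k + h * ?G z k)" for y z h
    using ij by (auto simp: fun_eq_iff algebra_simps)
  let ?P = "PiM {..<n} (\<lambda>_. cgauss 0 1)"
  have inv: "(\<integral>\<^sup>+y. f (?G y) \<partial>cgauss_vec n) = (\<integral>\<^sup>+y. f y \<partial>cgauss_vec n)"
    if f [measurable]: "f \<in> borel_measurable (vec_space n)" for f :: "(nat \<Rightarrow> complex) \<Rightarrow> ennreal"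
  proof -
    let ?Q = "PiM ({..<n} - {i, j}) (\<lambda>_. cgauss 0 1)"
    \<comment> \<open>With the other coordinates integrated out, the rotation acts on a function of
      two complex variables, as \<open>cgauss_rotation\<close> requires.\<close>
    define F where "F = (\<lambda>p. \<integral>\<^sup>+x. f (x(j := snd p, i := fst p)) \<partial>?Q)"
    have [measurable_cong]: "sets ?P = sets (vec_space n)"
      using sets_cgauss_vec[of n] by (simp add: cgauss_vec_def)
    have f' [measurable]: "f \<in> borel_measurable ?P"
      using f by (simp only: measurable_cong_sets[OF \<open>sets ?P = sets (vec_space n)\<close> refl])
    have upd': "(\<lambda>q. (snd q)(j := snd (fst q), i := fst (fst q))) \<in> (borel \<Otimes>\<^sub>M borel) \<Otimes>\<^sub>M ?Q \<rightarrow>\<^sub>M ?P"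
    proof (rule measurable_fun_upd[where J = "{..<n} - {i}"])
      show "(\<lambda>q. (snd q)(j := snd (fst q))) \<in> (borel \<Otimes>\<^sub>M borel) \<Otimes>\<^sub>M ?Q \<rightarrow>\<^sub>M PiM ({..<n} - {i}) (\<lambda>_. cgauss 0 1)"
        using ij by (intro measurable_fun_upd[where J = "{..<n} - {i, j}"]) auto
    qed (use ij in auto)
    have prob_Q: "prob_space ?Q"
      by (intro prob_space_PiM prob_space_cgauss_std)
    have [measurable]: "F \<in> borel_measurable (borel \<Otimes>\<^sub>M borel)"
      unfolding F_def
      by (rule sigma_finite_measure.borel_measurable_nn_integral[OF prob_space_imp_sigma_finite[OF prob_Q]])
         (use measurable_compose[OF upd' f'] in \<open>simp add: case_prod_beta\<close>)
    have "(\<integral>\<^sup>+y. f (?G y) \<partial>?P)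
        = (\<integral>\<^sup>+a. \<integral>\<^sup>+b. F (of_real c * a - cnj s * b, s * a + of_real c * b) \<partial>cgauss 0 1 \<partial>cgauss 0 1)"
    proof (subst nn_integral_PiM_two[of _ i j])
      show "(\<lambda>y. f (?G y)) \<in> borel_measurable ?P"
        using measurable_compose[OF G f]
        by (simp only: measurable_cong_sets[OF \<open>sets ?P = sets (vec_space n)\<close> refl])
    qed (use ij in \<open>simp_all add: F_def fun_upd_twist[of i j]\<close>)
    also have "\<dots> = (\<integral>\<^sup>+a. \<integral>\<^sup>+b. F (a, b) \<partial>cgauss 0 1 \<partial>cgauss 0 1)"
      by (rule cgauss_rotation[OF cs, of F]) measurable
    also have "\<dots> = (\<integral>\<^sup>+y. f y \<partial>?P)"
      using ij by (subst nn_integral_PiM_two[of _ i j]) (simp_all add: F_def)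
    finally show ?thesis by (simp add: cgauss_vec_def)
  qed
  have "distr (cgauss_vec n) (vec_space n) ?G = cgauss_vec n"
  proof (rule measure_eqI)
    fix A assume "A \<in> sets (distr (cgauss_vec n) (vec_space n) ?G)"
    then have [measurable]: "A \<in> sets (vec_space n)" by simp
    show "emeasure (distr (cgauss_vec n) (vec_space n) ?G) A = emeasure (cgauss_vec n) A"
      using inv[of "indicator A"]
      by (simp add: nn_integral_indicator[symmetric] nn_integral_distr del: nn_integral_indicator)
  qed simp
  then show ?thesis
    unfolding unitary_map_def using G norm lin by blast
qed

text \<open>Induction on the last coordinate that may be nonzero. A Givens rotation in the plane of
  coordinates 0 and \<open>Suc k\<close> produces \<open>x\<close> from a vector \<open>y\<close>
  vanishing in coordinate \<open>Suc k\<close>, to which the induction hypothesis applies. When only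
  coordinate 0 is left, a phase suffices.\<close>

lemma ex_unitary_map_axis:
  assumes x: "x \<in> space (vec_space n)" and n: "n \<ge> 1"
  shows "\<exists>U. unitary_map n U \<and> U (\<lambda>i\<in>{..<n}. if i = 0 then of_real (vnorm n x) else 0) = x"
proof -
  have "\<exists>U. unitary_map n U \<and> U (\<lambda>i\<in>{..<n}. if i = 0 then of_real (vnorm n x) else 0) = x"
    if "k < n" "x \<in> space (vec_space n)" "\<And>i. k < i \<Longrightarrow> i < n \<Longrightarrow> x i = 0" for k x
    using that
  proof (induction k arbitrary: x)
    case 0
    have "(\<Sum>i<n. (cmod (x i))\<^sup>2) = (\<Sum>i\<in>{0}. (cmod (x i))\<^sup>2)"
      using 0 by (intro sum.mono_neutral_right) auto
    then have norm: "vnorm n x = cmod (x 0)"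
      by (simp add: vnorm_def L2_set_def)
    define p where "p = (if x 0 = 0 then 1 else sgn (x 0))"
    have p: "cmod p = 1" "p * of_real (cmod (x 0)) = x 0"
      by (auto simp: p_def sgn_eq norm_divide)
    have "(\<lambda>i\<in>{..<n}. (if i = 0 then p else 1) * (\<lambda>i\<in>{..<n}. if i = 0 then of_real (vnorm n x) else 0) i) = x"
      using 0 p norm by (auto simp: fun_eq_iff space_vec_space extensional_def)
    then show ?case
      using unitary_map_phase[OF p(1)] by blast
  next
    case (Suc k)
    let ?j = "Suc k"
    define R where "R = sqrt ((cmod (x 0))\<^sup>2 + (cmod (x ?j))\<^sup>2)"
    have R2: "R\<^sup>2 = (cmod (x 0))\<^sup>2 + (cmod (x ?j))\<^sup>2" by (simp add: R_def)
    show ?case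
    proof (cases "R = 0")
      case True
      then have "x ?j = 0" using R2 by (simp add: add_nonneg_eq_0_iff)
      then show ?thesis
        using Suc by (metis Suc_lessD less_SucE linorder_neqE_nat not_less_eq)
    next
      case False
      define p where "p = (if x 0 = 0 then 1 else sgn (x 0))"
      have p: "cmod p = 1" "p * of_real (cmod (x 0)) = x 0"
        by (auto simp: p_def sgn_eq norm_divide)
      then have p0: "p \<noteq> 0" by auto
      \<comment> \<open>\<open>a\<close> carries the joint modulus of the two entries and the phase
        of \<open>x 0\<close>, so that the cosine \<open>x 0 / a\<close> is the real number
        \<open>c\<close>.\<close>
      define a where "a = of_real R * p"
      define c where "c = cmod (x 0) / R"
      define s where "s = x ?j / a"
      have a0: "a \<noteq> 0" and norm_a: "(cmod a)\<^sup>2 = R\<^sup>2"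
        using False p0 p by (auto simp: a_def norm_mult power_mult_distrib)
      have cs: "c\<^sup>2 + (cmod s)\<^sup>2 = 1"
        using False
        by (simp add: c_def s_def norm_divide power_divide norm_a add_divide_distrib[symmetric] R2[symmetric])
      have ca: "of_real c * a = x 0" and sa: "s * a = x ?j"
        using False p a0 by (auto simp: c_def s_def a_def mult.commute)
      define y where "y = x(0 := a, ?j := 0)"
      let ?G = "\<lambda>y. y(0 := of_real c * y 0 - cnj s * y ?j, ?j := s * y 0 + of_real c * y ?j)"
      have G: "unitary_map n ?G"
        using Suc.prems(1) by (intro unitary_map_givens cs) auto
      have Gy: "?G y = x"
        by (auto simp: y_def ca sa fun_eq_iff)
      have y: "y \<in> space (vec_space n)" "\<And>i. k < i \<Longrightarrow> i < n \<Longrightarrow> y i = 0"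
        using Suc.prems by (auto simp: y_def space_vec_space extensional_def)
      have "vnorm n y = vnorm n x"
      proof -
        have "vnorm n (?G y) = vnorm n y"
          using G y(1) unfolding unitary_map_def by blast
        then show ?thesis by (simp only: Gy)
      qed
      with Suc.IH[OF Suc_lessD[OF Suc.prems(1)] y]
      obtain U where U: "unitary_map n U"
          "U (\<lambda>i\<in>{..<n}. if i = 0 then of_real (vnorm n x) else 0) = y"
        by (simp only: \<open>vnorm n y = vnorm n x\<close>) blast
      then have "?G (U (\<lambda>i\<in>{..<n}. if i = 0 then of_real (vnorm n x) else 0)) = x"
        using Gy by simp
      then show ?thesis
        using unitary_map_comp[OF G U(1)] by blast
    qed
  qed
  \<comment> \<open>With \<open>k = n - 1\<close> the vanishing condition is vacuous, so every
    vector qualifies.\<close>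
  from this[of "n - 1" x] show ?thesis
    using assms by auto
qed

subsection \<open>The mixture output density\<close>

lemma summable_bessel: "summable (\<lambda>m. (x / 2) ^ (2 * m + \<nu>) / (fact m * Gamma (real m + real \<nu> + 1)))"
proof (rule summable_comparison_test')
  let ?y = "\<bar>x / 2\<bar>"
  show "summable (\<lambda>m. ?y ^ \<nu> * (inverse (fact m) * (?y\<^sup>2) ^ m))"
    by (intro summable_mult summable_exp)
  fix m :: nat assume "m \<ge> 0"
  have "Gamma (real m + real \<nu> + 1) = fact (m + \<nu>)"
    using Gamma_fact[of "m + \<nu>", where 'a = real] by (simp add: add_ac)
  moreover have "(fact (m + \<nu>) :: real) \<ge> 1" by (rule fact_ge_1)
  ultimately have "norm ((x / 2) ^ (2 * m + \<nu>) / (fact m * Gamma (real m + real \<nu> + 1)))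
      \<le> ?y ^ (2 * m + \<nu>) / fact m"
    by (simp add: abs_mult power_abs frac_le)
  also have "\<dots> = ?y ^ \<nu> * (inverse (fact m) * (?y\<^sup>2) ^ m)"
    unfolding power_add power_mult by (simp only: divide_inverse mult_ac)
  finally show "norm ((x / 2) ^ (2 * m + \<nu>) / (fact m * Gamma (real m + real \<nu> + 1)))
      \<le> ?y ^ \<nu> * (inverse (fact m) * (?y\<^sup>2) ^ m)" .
qed

lemma ennreal_bessel_I:
  assumes "x \<ge> 0"
  shows "ennreal (bessel_I \<nu> x)
    = (\<Sum>m. ennreal ((x / 2) ^ (2 * m + \<nu>) / (fact m * Gamma (real m + real \<nu> + 1))))"
  unfolding bessel_I_def using assms
  by (intro suminf_ennreal2[symmetric] summable_bessel)
     (auto intro!: divide_nonneg_nonneg mult_nonneg_nonneg Gamma_real_nonneg)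

lemma bessel_I_pos: "x > 0 \<Longrightarrow> bessel_I \<nu> x > 0"
  unfolding bessel_I_def by (intro suminf_pos summable_bessel) (auto intro!: divide_pos_pos mult_pos_pos Gamma_real_pos)

text \<open>At order 0 the constant term of the series is 1, so positivity extends to the argument
  0. This covers \<open>\<kappa> = 0\<close>, where the fading has mean 0.\<close>

lemma bessel_I_0_pos: "x \<ge> 0 \<Longrightarrow> bessel_I 0 x > 0"
  unfolding bessel_I_def
  by (intro suminf_pos2[where i = 0] summable_bessel)
     (auto intro!: divide_nonneg_nonneg mult_nonneg_nonneg Gamma_real_nonneg)

lemma bessel_I_nonneg: "x \<ge> 0 \<Longrightarrow> bessel_I \<nu> x \<ge> 0"
  unfolding bessel_I_def
  by (intro suminf_nonneg summable_bessel)
     (auto intro!: divide_nonneg_nonneg mult_nonneg_nonneg Gamma_real_nonneg)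

lemma borel_measurable_bessel_I [measurable]: "bessel_I \<nu> \<in> borel_measurable borel"
  unfolding bessel_I_def[abs_def] by measurable

text \<open>For \<open>s > 0\<close> both sides agree. At \<open>s = 0\<close> and positive order
  the quotient is 0 by the division convention while the series starts with
  \<open>1 / fact \<nu>\<close>, hence only an inequality.\<close>

lemma bessel_I_quotient:
  assumes "s \<ge> 0"
  shows "ennreal (bessel_I \<nu> (2 * s) / s ^ \<nu>)
    \<le> (\<Sum>m. ennreal ((s\<^sup>2) ^ m / (fact m * fact (m + \<nu>))))"
proof (cases "s = 0")
  case True
  have "ennreal (bessel_I \<nu> (2 * s) / s ^ \<nu>) \<le> ennreal ((s\<^sup>2) ^ 0 / (fact 0 * fact (0 + \<nu>)))"
  proof (cases "\<nu> = 0")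
    case True
    have "bessel_I 0 0 = 1"
      unfolding bessel_I_def by (subst suminf_finite[of "{0}"]) auto
    then show ?thesis using True \<open>s = 0\<close> by simp
  next
    case False
    then show ?thesis using \<open>s = 0\<close> by (simp add: power_0_left)
  qed
  also have "\<dots> \<le> (\<Sum>m. ennreal ((s\<^sup>2) ^ m / (fact m * fact (m + \<nu>))))"
    using ennreal_suminf_lessD[of "\<lambda>m. ennreal ((s\<^sup>2) ^ m / (fact m * fact (m + \<nu>)))" _ 0]
    by (meson linorder_not_le less_irrefl)
  finally show ?thesis .
next
  case False
  then have s: "s > 0" using assms by simp
  have "ennreal (bessel_I \<nu> (2 * s) / s ^ \<nu>) = ennreal (1 / s ^ \<nu>) * ennreal (bessel_I \<nu> (2 * s))"
    using s bessel_I_pos[of "2 * s" \<nu>] by (subst ennreal_mult[symmetric]) auto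
  also have "\<dots> = (\<Sum>m. ennreal (1 / s ^ \<nu>) * ennreal ((2 * s / 2) ^ (2 * m + \<nu>) / (fact m * Gamma (real m + real \<nu> + 1))))"
    using s by (subst ennreal_bessel_I) simp_all
  also have "\<dots> = (\<Sum>m. ennreal ((s\<^sup>2) ^ m / (fact m * fact (m + \<nu>))))"
  proof (rule suminf_cong)
    fix m
    have "Gamma (real m + real \<nu> + 1) = fact (m + \<nu>)"
      using Gamma_fact[of "m + \<nu>", where 'a = real] by (simp add: add_ac)
    then show "ennreal (1 / s ^ \<nu>) * ennreal ((2 * s / 2) ^ (2 * m + \<nu>) / (fact m * Gamma (real m + real \<nu> + 1)))
        = ennreal ((s\<^sup>2) ^ m / (fact m * fact (m + \<nu>)))"
      using s by (simp add: ennreal_mult[symmetric] power_add power_mult)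
  qed
  finally show ?thesis by simp
qed

text \<open>Normalization of the Erlang density of shape \<open>k + 1\<close> and rate
  \<open>b\<close>.\<close>

lemma nn_integral_power_exp:
  assumes b: "b > 0"
  shows "(\<integral>\<^sup>+z. ennreal (z ^ k * exp (- b * z)) * indicator {0..} z \<partial>lborel) = ennreal (fact k / b ^ Suc k)"
proof -
  have "(\<integral>\<^sup>+z. ennreal (z ^ k * exp (- b * z)) * indicator {0..} z \<partial>lborel)
      = (\<integral>\<^sup>+z. ennreal (fact k / b ^ Suc k) * ennreal (erlang_density k b z) \<partial>lborel)"
    using b by (intro nn_integral_cong)
      (auto simp: erlang_density_def ennreal_mult[symmetric] indicator_def not_le)
  also have "\<dots> = ennreal (fact k / b ^ Suc k)"
    using prob_space.emeasure_space_1[OF prob_space_erlang_density[OF b, of k]]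
    by (simp add: nn_integral_cmult emeasure_density)
  finally show ?thesis .
qed

lemma suminf_ennreal_exp:
  assumes "c \<ge> 0" "x \<ge> 0"
  shows "(\<Sum>m. ennreal (c * (inverse (fact m) * x ^ m))) = ennreal (c * exp x)"
proof (rule suminf_ennreal_eq)
  show "(\<lambda>m. c * (inverse (fact m) * x ^ m)) sums (c * exp x)"
    using exp_converges[of x] by (intro sums_mult) simp
qed (use assms in auto)

section \<open>The mixture density and its total mass\<close>

lemma sigma2_H_pos: "\<kappa> \<ge> 0 \<Longrightarrow> sigma2_H \<kappa> > 0"
  by (simp add: sigma2_H_def)

text \<open>\<open>z\<close> is the squared modulus of the fading coefficient. The factors
  \<open>exp (- z / \<sigma>2)\<close> and \<open>bessel_I 0\<close> form its noncentral chi-square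
  density; the others form the average, over the input sphere, of the likelihood ratio of the output
  against pure noise at output norm \<open>r\<close>. The constants missing from the two,
  \<open>exp (- \<mu>\<^sup>2 / \<sigma>2) / \<sigma>2\<close> and \<open>Gamma n\<close>, are
  restored in \<open>mix_density\<close>.\<close>

definition mix_integrand :: "real \<Rightarrow> nat \<Rightarrow> real \<Rightarrow> real \<Rightarrow> real \<Rightarrow> real" where
  "mix_integrand \<kappa> n \<rho> r z =
     exp (- (\<rho> * real n + inverse (sigma2_H \<kappa>)) * z) / (r * sqrt (\<rho> * real n * z)) ^ (n - 1)
     * bessel_I (n - 1) (2 * r * sqrt (\<rho> * real n * z))
     * bessel_I 0 (2 * inverse (sigma2_H \<kappa>) * sqrt (z * \<bar>mu_H \<kappa>\<bar>\<^sup>2))"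

definition mix_integral :: "real \<Rightarrow> nat \<Rightarrow> real \<Rightarrow> real \<Rightarrow> real" where
  "mix_integral \<kappa> n \<rho> r = (LBINT z:{0..}. mix_integrand \<kappa> n \<rho> r z)"

text \<open>The law with this density with respect to \<open>cgauss_vec n\<close> is the output law of one block whose
  input is uniform on the sphere of radius \<open>sqrt (n \<rho>)\<close>.\<close>

definition mix_density :: "real \<Rightarrow> nat \<Rightarrow> real \<Rightarrow> (nat \<Rightarrow> complex) \<Rightarrow> real" where
  "mix_density \<kappa> n \<rho> y =
     Gamma (real n) / sigma2_H \<kappa> * exp (- \<bar>mu_H \<kappa>\<bar>\<^sup>2 / sigma2_H \<kappa>) * mix_integral \<kappa> n \<rho> (vnorm n y)"

context
  fixes n :: nat and \<kappa> \<rho> :: real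
  assumes n: "n \<ge> 1" and \<kappa>: "\<kappa> \<ge> 0" and \<rho>: "\<rho> > 0"
begin

lemma mix_integrand_nonneg: "r \<ge> 0 \<Longrightarrow> z \<ge> 0 \<Longrightarrow> mix_integrand \<kappa> n \<rho> r z \<ge> 0"
  unfolding mix_integrand_def using \<rho> sigma2_H_pos[OF \<kappa>]
  by (intro mult_nonneg_nonneg divide_nonneg_nonneg bessel_I_nonneg zero_le_power) auto

lemma mix_integrand_pos: "r > 0 \<Longrightarrow> z > 0 \<Longrightarrow> mix_integrand \<kappa> n \<rho> r z > 0"
  unfolding mix_integrand_def using n \<rho> sigma2_H_pos[OF \<kappa>]
  by (intro mult_pos_pos divide_pos_pos bessel_I_pos bessel_I_0_pos) auto

lemma mix_integrand_measurable [measurable]: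
  "(\<lambda>p. mix_integrand \<kappa> n \<rho> (fst p) (snd p)) \<in> borel_measurable (borel \<Otimes>\<^sub>M borel)"
  unfolding mix_integrand_def by measurable

lemma mix_integral_measurable [measurable]: "mix_integral \<kappa> n \<rho> \<in> borel_measurable borel"
  unfolding mix_integral_def[abs_def] set_lebesgue_integral_def
  using mix_integrand_measurable by measurable

lemma mix_integral_nonneg: "r \<ge> 0 \<Longrightarrow> mix_integral \<kappa> n \<rho> r \<ge> 0"
  unfolding mix_integral_def set_lebesgue_integral_def
  by (intro integral_nonneg_AE AE_I2) (auto simp: indicator_def mix_integrand_nonneg)

lemma mix_density_measurable [measurable]: "mix_density \<kappa> n \<rho> \<in> borel_measurable (vec_space n)"
  unfolding mix_density_def[abs_def] by measurable

lemma mix_density_nonneg: "mix_density \<kappa> n \<rho> y \<ge> 0"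
  unfolding mix_density_def using sigma2_H_pos[OF \<kappa>] n
  by (intro mult_nonneg_nonneg divide_nonneg_nonneg mix_integral_nonneg) (auto intro: Gamma_real_nonneg)

text \<open>Both Bessel factors become power series in \<open>r\<^sup>2\<close> and
  \<open>z\<close>, the form in which Gaussian and Erlang moments can be inserted term by
  term.\<close>

lemma mix_integrand_le:
  assumes "r \<ge> 0" "z \<ge> 0"
  defines "a \<equiv> \<rho> * real n" and "b \<equiv> inverse (sigma2_H \<kappa>)" and "\<mu>2 \<equiv> \<bar>mu_H \<kappa>\<bar>\<^sup>2"
  shows "ennreal (mix_integrand \<kappa> n \<rho> r z)
    \<le> ennreal (exp (- (a + b) * z)) * (\<Sum>m. ennreal ((a * z) ^ m / (fact m * fact (m + (n - 1)))) * ennreal ((r\<^sup>2) ^ m))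
      * (\<Sum>k. ennreal ((b\<^sup>2 * \<mu>2 * z) ^ k / (fact k)\<^sup>2))"
proof -
  have pos: "a \<ge> 0" "b \<ge> 0" "\<mu>2 \<ge> 0"
    using \<rho> sigma2_H_pos[OF \<kappa>] by (auto simp: a_def b_def \<mu>2_def)
  define s where "s = r * sqrt (a * z)"
  define t where "t = b * sqrt (z * \<mu>2)"
  have st: "s \<ge> 0" "t \<ge> 0" "s\<^sup>2 = a * z * r\<^sup>2" "t\<^sup>2 = b\<^sup>2 * \<mu>2 * z"
    using pos assms(1,2) by (simp_all add: s_def t_def power_mult_distrib mult_ac)
  \<comment> \<open>The factor \<open>t ^ 0\<close> brings the second Bessel function into the form
    of \<open>bessel_I_quotient\<close> as well.\<close>
  have eq: "mix_integrand \<kappa> n \<rho> r z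
      = exp (- (a + b) * z) * (bessel_I (n - 1) (2 * s) / s ^ (n - 1)) * (bessel_I 0 (2 * t) / t ^ 0)"
    by (simp add: mix_integrand_def s_def t_def a_def b_def \<mu>2_def mult.assoc)
  have "ennreal (mix_integrand \<kappa> n \<rho> r z) = ennreal (exp (- (a + b) * z))
      * ennreal (bessel_I (n - 1) (2 * s) / s ^ (n - 1)) * ennreal (bessel_I 0 (2 * t) / t ^ 0)"
    unfolding eq using st bessel_I_nonneg[of "2 * s" "n - 1"] bessel_I_nonneg[of "2 * t" 0]
    by (subst ennreal_mult, simp, simp, subst ennreal_mult) simp_all
  also have "\<dots> \<le> ennreal (exp (- (a + b) * z))
      * (\<Sum>m. ennreal ((s\<^sup>2) ^ m / (fact m * fact (m + (n - 1)))))
      * (\<Sum>k. ennreal ((t\<^sup>2) ^ k / (fact k * fact (k + 0))))"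
    using st by (intro mult_mono bessel_I_quotient) simp_all
  also have "(\<Sum>m. ennreal ((s\<^sup>2) ^ m / (fact m * fact (m + (n - 1)))))
      = (\<Sum>m. ennreal ((a * z) ^ m / (fact m * fact (m + (n - 1)))) * ennreal ((r\<^sup>2) ^ m))"
    using pos assms(1,2)
    by (intro suminf_cong) (simp add: st power_mult_distrib ennreal_mult[symmetric])
  also have "(\<Sum>k. ennreal ((t\<^sup>2) ^ k / (fact k * fact (k + 0))))
      = (\<Sum>k. ennreal ((b\<^sup>2 * \<mu>2 * z) ^ k / (fact k)\<^sup>2))"
    unfolding st by (simp add: power2_eq_square)
  finally show ?thesis .
qed

lemma mix_nn_measurable [measurable]:
  "(\<lambda>y. \<integral>\<^sup>+z. ennreal (mix_integrand \<kappa> n \<rho> (vnorm n y) z) * indicator {0..} z \<partial>lborel)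
    \<in> borel_measurable (cgauss_vec n)"
proof (rule lborel.borel_measurable_nn_integral)
  have [measurable]: "(\<lambda>p. mix_integrand \<kappa> n \<rho> (vnorm n (fst p)) (snd p)) \<in> borel_measurable (cgauss_vec n \<Otimes>\<^sub>M lborel)"
    using measurable_compose[OF _ mix_integrand_measurable, of "\<lambda>p. (vnorm n (fst p), snd p)" "cgauss_vec n \<Otimes>\<^sub>M lborel"]
    by simp
  show "(\<lambda>(y, z). ennreal (mix_integrand \<kappa> n \<rho> (vnorm n y) z) * indicator {0..} z) \<in> borel_measurable (cgauss_vec n \<Otimes>\<^sub>M lborel)"
    unfolding case_prod_beta by measurable
qed

text \<open>With \<open>y\<close> integrated first, the moment \<open>pochhammer n m\<close> turns
  \<open>1 / (m! (m + n - 1)!)\<close> into \<open>1 / (m! Gamma n)\<close>; the series becomes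
  \<open>exp (a * z) / Gamma n\<close> and cancels \<open>exp (- a * z)\<close>. The Erlang integral
  \<open>k! / b^(k+1)\<close> then turns the second series into
  \<open>exp (b * \<mu>2) / b\<close>.\<close>

lemma nn_integral_mix:
  defines "b \<equiv> inverse (sigma2_H \<kappa>)" and "\<mu>2 \<equiv> \<bar>mu_H \<kappa>\<bar>\<^sup>2"
  shows "(\<integral>\<^sup>+y. \<integral>\<^sup>+z. ennreal (mix_integrand \<kappa> n \<rho> (vnorm n y) z) * indicator {0..} z \<partial>lborel \<partial>cgauss_vec n)
    \<le> ennreal (exp (b * \<mu>2) / (b * Gamma (real n)))"
proof -
  define a where "a = \<rho> * real n"
  have pos: "a > 0" "b > 0" "\<mu>2 \<ge> 0"
    using n \<rho> sigma2_H_pos[OF \<kappa>] by (auto simp: a_def b_def \<mu>2_def)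
  interpret N: prob_space "cgauss_vec n" by (rule prob_space_cgauss_vec)
  interpret NL: pair_sigma_finite "cgauss_vec n" lborel ..
  let ?B = "\<lambda>z. \<Sum>k. ennreal ((b\<^sup>2 * \<mu>2 * z) ^ k / (fact k)\<^sup>2)"
  have "(\<integral>\<^sup>+y. \<integral>\<^sup>+z. ennreal (mix_integrand \<kappa> n \<rho> (vnorm n y) z) * indicator {0..} z \<partial>lborel \<partial>cgauss_vec n)
      = (\<integral>\<^sup>+z. \<integral>\<^sup>+y. ennreal (mix_integrand \<kappa> n \<rho> (vnorm n y) z) * indicator {0..} z \<partial>cgauss_vec n \<partial>lborel)"
  proof (rule NL.Fubini'[symmetric])
    have [measurable]: "(\<lambda>p. mix_integrand \<kappa> n \<rho> (vnorm n (fst p)) (snd p)) \<in> borel_measurable (cgauss_vec n \<Otimes>\<^sub>M lborel)"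
      using measurable_compose[OF _ mix_integrand_measurable, of "\<lambda>p. (vnorm n (fst p), snd p)" "cgauss_vec n \<Otimes>\<^sub>M lborel"]
      by simp
    show "(\<lambda>(y, z). ennreal (mix_integrand \<kappa> n \<rho> (vnorm n y) z) * indicator {0..} z) \<in> borel_measurable (cgauss_vec n \<Otimes>\<^sub>M lborel)"
      unfolding case_prod_beta by measurable
  qed
  also have "\<dots> \<le> (\<integral>\<^sup>+z. ennreal (exp (- b * z)) * ?B z * indicator {0..} z * ennreal (1 / Gamma (real n)) \<partial>lborel)"
  proof (rule nn_integral_mono)
    fix z :: real
    show "(\<integral>\<^sup>+y. ennreal (mix_integrand \<kappa> n \<rho> (vnorm n y) z) * indicator {0..} z \<partial>cgauss_vec n)
        \<le> ennreal (exp (- b * z)) * ?B z * indicator {0..} z * ennreal (1 / Gamma (real n))"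
    proof (cases "z \<ge> 0")
      case True
      have "(\<integral>\<^sup>+y. ennreal (mix_integrand \<kappa> n \<rho> (vnorm n y) z) * indicator {0..} z \<partial>cgauss_vec n)
          \<le> (\<integral>\<^sup>+y. ennreal (exp (- (a + b) * z)) * (\<Sum>m. ennreal ((a * z) ^ m / (fact m * fact (m + (n - 1)))) * ennreal (((vnorm n y)\<^sup>2) ^ m)) * ?B z \<partial>cgauss_vec n)"
        by (rule nn_integral_mono)
           (use True mix_integrand_le[OF vnorm_nonneg True, folded a_def b_def \<mu>2_def] in simp)
      also have "\<dots> = ennreal (exp (- (a + b) * z)) * (\<Sum>m. ennreal ((a * z) ^ m / (fact m * fact (m + (n - 1)))) * ennreal (pochhammer (real n) m)) * ?B z"
        by (simp add: nn_integral_multc nn_integral_cmult nn_integral_suminf cgauss_vec_moments)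
      also have "(\<Sum>m. ennreal ((a * z) ^ m / (fact m * fact (m + (n - 1)))) * ennreal (pochhammer (real n) m))
          = (\<Sum>m. ennreal (1 / Gamma (real n) * (inverse (fact m) * (a * z) ^ m)))"
      proof (rule suminf_cong)
        fix m
        have "fact (m + (n - 1)) = Gamma (real n + real m)"
          using n by (simp add: Gamma_fact[symmetric] of_nat_diff add.commute)
        moreover have "pochhammer (real n) m = Gamma (real n + real m) / Gamma (real n)"
          using n by (intro pochhammer_Gamma) (auto simp: nonpos_Ints_def)
        moreover have "Gamma (real n) > 0" "Gamma (real n + real m) > 0"
          using n by (auto intro!: Gamma_real_pos)
        ultimately have "(a * z) ^ m / (fact m * fact (m + (n - 1))) * pochhammer (real n) m
            = 1 / Gamma (real n) * (inverse (fact m) * (a * z) ^ m)"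
          by (simp add: field_simps)
        then show "ennreal ((a * z) ^ m / (fact m * fact (m + (n - 1)))) * ennreal (pochhammer (real n) m)
            = ennreal (1 / Gamma (real n) * (inverse (fact m) * (a * z) ^ m))"
          using True pos by (subst ennreal_mult'[symmetric]) simp_all
      qed
      also have "\<dots> = ennreal (1 / Gamma (real n) * exp (a * z))"
        using True pos n by (intro suminf_ennreal_exp) (auto intro: Gamma_real_nonneg)
      also have "ennreal (exp (- (a + b) * z)) * ennreal (1 / Gamma (real n) * exp (a * z)) * ?B z
          = ennreal (exp (- b * z)) * ?B z * indicator {0..} z * ennreal (1 / Gamma (real n))"
      proof -
        have "exp (- (a + b) * z) * (1 / Gamma (real n) * exp (a * z)) = exp (- b * z) * (1 / Gamma (real n))"
          by (simp add: exp_add[symmetric] algebra_simps)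
        then have "ennreal (exp (- (a + b) * z)) * ennreal (1 / Gamma (real n) * exp (a * z))
            = ennreal (exp (- b * z)) * ennreal (1 / Gamma (real n))"
          using n by (simp only: ennreal_mult''[symmetric] Gamma_real_nonneg exp_ge_zero mult_nonneg_nonneg divide_nonneg_nonneg zero_le_one of_nat_0_le_iff)
        then show ?thesis using True by (simp add: mult_ac)
      qed
      finally show ?thesis .
    qed simp
  qed
  also have "\<dots> = (\<integral>\<^sup>+z. (\<Sum>k. ennreal ((b\<^sup>2 * \<mu>2) ^ k / (fact k)\<^sup>2) * (ennreal (z ^ k * exp (- b * z)) * indicator {0..} z)) \<partial>lborel)
      * ennreal (1 / Gamma (real n))"
  proof (subst nn_integral_multc[symmetric])
    show "(\<integral>\<^sup>+z. ennreal (exp (- b * z)) * ?B z * indicator {0..} z * ennreal (1 / Gamma (real n)) \<partial>lborel)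
      = (\<integral>\<^sup>+z. (\<Sum>k. ennreal ((b\<^sup>2 * \<mu>2) ^ k / (fact k)\<^sup>2) * (ennreal (z ^ k * exp (- b * z)) * indicator {0..} z)) * ennreal (1 / Gamma (real n)) \<partial>lborel)"
    proof (intro nn_integral_cong arg_cong2[where f = "(*)"] refl)
      fix z :: real
      have "ennreal ((b\<^sup>2 * \<mu>2) ^ k / (fact k)\<^sup>2) * ennreal (z ^ k * exp (- b * z))
          = ennreal (exp (- b * z)) * ennreal ((b\<^sup>2 * \<mu>2 * z) ^ k / (fact k)\<^sup>2)" if "z \<ge> 0" for k
        using that pos by (simp add: ennreal_mult[symmetric] power_mult_distrib mult_ac)
      then show "ennreal (exp (- b * z)) * ?B z * indicator {0..} z
          = (\<Sum>k. ennreal ((b\<^sup>2 * \<mu>2) ^ k / (fact k)\<^sup>2) * (ennreal (z ^ k * exp (- b * z)) * indicator {0..} z))"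
        by (cases "z \<ge> 0") simp_all
    qed
  qed measurable
  also have "\<dots> = (\<Sum>k. ennreal ((b\<^sup>2 * \<mu>2) ^ k / (fact k)\<^sup>2) * ennreal (fact k / b ^ Suc k)) * ennreal (1 / Gamma (real n))"
    by (simp add: nn_integral_suminf nn_integral_cmult nn_integral_power_exp[OF pos(2), simplified])
  also have "(\<Sum>k. ennreal ((b\<^sup>2 * \<mu>2) ^ k / (fact k)\<^sup>2) * ennreal (fact k / b ^ Suc k))
      = (\<Sum>k. ennreal (1 / b * (inverse (fact k) * (b * \<mu>2) ^ k)))"
  proof (rule suminf_cong)
    fix k
    have "(b\<^sup>2 * \<mu>2) ^ k / (fact k)\<^sup>2 * (fact k / b ^ Suc k) = 1 / b * (inverse (fact k) * (b * \<mu>2) ^ k)"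
      using pos by (simp add: power2_eq_square power_mult_distrib field_simps)
    then show "ennreal ((b\<^sup>2 * \<mu>2) ^ k / (fact k)\<^sup>2) * ennreal (fact k / b ^ Suc k)
        = ennreal (1 / b * (inverse (fact k) * (b * \<mu>2) ^ k))"
      using pos by (simp add: ennreal_mult[symmetric])
  qed
  also have "\<dots> = ennreal (1 / b * exp (b * \<mu>2))"
    using pos by (intro suminf_ennreal_exp) auto
  also have "\<dots> * ennreal (1 / Gamma (real n)) = ennreal (exp (b * \<mu>2) / (b * Gamma (real n)))"
    using pos n by (simp add: ennreal_mult[symmetric] Gamma_real_nonneg)
  finally show ?thesis .
qed

text \<open>The normalizing constant of \<open>mix_density\<close> is the reciprocal of the bound in
  \<open>nn_integral_mix\<close>.\<close>

lemma nn_integral_mix_density: "(\<integral>\<^sup>+y. ennreal (mix_density \<kappa> n \<rho> y) \<partial>cgauss_vec n) \<le> 1"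
proof -
  define C where "C = Gamma (real n) / sigma2_H \<kappa> * exp (- \<bar>mu_H \<kappa>\<bar>\<^sup>2 / sigma2_H \<kappa>)"
  have C: "C \<ge> 0"
    using n sigma2_H_pos[OF \<kappa>] by (auto simp: C_def intro!: mult_nonneg_nonneg divide_nonneg_nonneg Gamma_real_nonneg)
  have "ennreal (mix_integral \<kappa> n \<rho> r) \<le> (\<integral>\<^sup>+z. ennreal (mix_integrand \<kappa> n \<rho> r z) * indicator {0..} z \<partial>lborel)"
    if "r \<ge> 0" for r
  proof (cases "integrable lborel (\<lambda>z. indicator {0..} z *\<^sub>R mix_integrand \<kappa> n \<rho> r z)")
    case True
    then have "ennreal (mix_integral \<kappa> n \<rho> r) = (\<integral>\<^sup>+z. ennreal (indicator {0..} z *\<^sub>R mix_integrand \<kappa> n \<rho> r z) \<partial>lborel)"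
      unfolding mix_integral_def set_lebesgue_integral_def
      using that by (intro nn_integral_eq_integral[symmetric] AE_I2) (auto simp: indicator_def mix_integrand_nonneg)
    also have "\<dots> = (\<integral>\<^sup>+z. ennreal (mix_integrand \<kappa> n \<rho> r z) * indicator {0..} z \<partial>lborel)"
      by (intro nn_integral_cong) (auto simp: indicator_def)
    finally show ?thesis by simp
  next
    \<comment> \<open>A divergent integral has Bochner value 0, so the inequality persists.\<close>
    case False
    then show ?thesis
      by (simp add: mix_integral_def set_lebesgue_integral_def not_integrable_integral_eq)
  qed
  then have "(\<integral>\<^sup>+y. ennreal (mix_density \<kappa> n \<rho> y) \<partial>cgauss_vec n)
      \<le> (\<integral>\<^sup>+y. ennreal C * (\<integral>\<^sup>+z. ennreal (mix_integrand \<kappa> n \<rho> (vnorm n y) z) * indicator {0..} z \<partial>lborel) \<partial>cgauss_vec n)"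
    unfolding mix_density_def C_def[symmetric] using C
    by (intro nn_integral_mono) (simp add: ennreal_mult mix_integral_nonneg mult_left_mono)
  also have "\<dots> = ennreal C * (\<integral>\<^sup>+y. \<integral>\<^sup>+z. ennreal (mix_integrand \<kappa> n \<rho> (vnorm n y) z) * indicator {0..} z \<partial>lborel \<partial>cgauss_vec n)"
    by (rule nn_integral_cmult) (rule mix_nn_measurable)
  also have "\<dots> \<le> ennreal C * ennreal (exp (inverse (sigma2_H \<kappa>) * \<bar>mu_H \<kappa>\<bar>\<^sup>2) / (inverse (sigma2_H \<kappa>) * Gamma (real n)))"
    by (intro mult_left_mono nn_integral_mix) simp
  also have "\<dots> = 1"
  proof -
    have "Gamma (real n) > 0" using n by (intro Gamma_real_pos) simp
    then have "C * (exp (inverse (sigma2_H \<kappa>) * \<bar>mu_H \<kappa>\<bar>\<^sup>2) / (inverse (sigma2_H \<kappa>) * Gamma (real n))) = 1"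
      using sigma2_H_pos[OF \<kappa>] by (simp add: C_def exp_minus field_simps)
    then show ?thesis
      using C by (simp only: ennreal_mult'[symmetric] ennreal_1)
  qed
  finally show ?thesis .
qed

section \<open>Almost sure positivity of the Bessel integral\<close>

lemma AE_vnorm_pos: "AE y in cgauss_vec n. vnorm n y > 0"
proof -
  have "AE z in lborel. z \<noteq> (0 :: complex)"
    by (rule AE_lborel_singleton)
  then have "AE z in cgauss 0 1. z \<noteq> 0"
    by (rule AE_cgauss_lborel)
  then have "AE y in cgauss_vec n. y 0 \<noteq> 0"
    unfolding cgauss_vec_def using n prob_space_cgauss_std
    by (intro AE_PiM_component[where P = "\<lambda>z. z \<noteq> 0"]) auto
  then show ?thesis
  proof eventually_elim
    case (elim y)
    then have "vnorm n y \<noteq> 0"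
      using n unfolding vnorm_def by (subst L2_set_eq_0_iff) auto
    then show ?case by (simp add: less_le)
  qed
qed

text \<open>Finiteness of the Gaussian average makes the integral converge almost everywhere, so its
  Bochner value is the true one. A nonnegative integrand that is positive on \<open>(0, 1)\<close>
  is not null almost everywhere. Norm 0 is excluded because there, for \<open>n > 1\<close>,
  division by zero makes the integrand vanish.\<close>

lemma AE_mix_integral_pos: "AE y in cgauss_vec n. mix_integral \<kappa> n \<rho> (vnorm n y) > 0"
proof -
  let ?K = "\<lambda>y. \<integral>\<^sup>+z. ennreal (mix_integrand \<kappa> n \<rho> (vnorm n y) z) * indicator {0..} z \<partial>lborel"
  have "(\<integral>\<^sup>+y. ?K y \<partial>cgauss_vec n) \<noteq> \<infinity>"
    using nn_integral_mix by (auto simp: top_unique)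
  then have "AE y in cgauss_vec n. ?K y \<noteq> \<infinity>"
    by (intro nn_integral_noteq_infinite mix_nn_measurable)
  with AE_vnorm_pos show ?thesis
  proof eventually_elim
    case (elim y)
    define r where "r = vnorm n y"
    have r: "r > 0" using elim by (simp add: r_def)
    let ?f = "\<lambda>z. indicator {0..} z *\<^sub>R mix_integrand \<kappa> n \<rho> r z"
    have [measurable]: "mix_integrand \<kappa> n \<rho> r \<in> borel_measurable borel"
      using measurable_compose[OF _ mix_integrand_measurable, of "\<lambda>z. (r, z)" borel] by simp
    have nonneg: "?f z \<ge> 0" for z
      using r by (auto simp: indicator_def mix_integrand_nonneg)
    have K: "?K y = (\<integral>\<^sup>+z. ennreal (?f z) \<partial>lborel)"
      unfolding r_def by (intro nn_integral_cong) (auto simp: indicator_def)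
    then have "(\<integral>\<^sup>+z. ennreal (?f z) \<partial>lborel) < \<infinity>"
      using elim by (simp add: less_top)
    then have int: "integrable lborel ?f"
      using nonneg by (intro integrableI_nonneg) auto
    have "mix_integral \<kappa> n \<rho> r \<noteq> 0"
    proof
      assume "mix_integral \<kappa> n \<rho> r = 0"
      then have "AE z in lborel. ?f z = 0"
        using integral_nonneg_eq_0_iff_AE[OF int] nonneg
        by (simp add: mix_integral_def set_lebesgue_integral_def)
      then have "AE z in lborel. z \<notin> {0<..<1::real}"
        by eventually_elim (use mix_integrand_pos[OF r] in \<open>force simp: indicator_def\<close>)
      moreover have "{z \<in> space lborel. \<not> z \<notin> {0<..<1::real}} = {0<..<1}"
        by auto
      ultimately have "emeasure lborel {0<..<1::real} = 0"
        by (subst (asm) AE_iff_measurable[of "{0<..<1}"]) auto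
      then show False by simp
    qed
    then show ?case
      using mix_integral_nonneg[of r] r by (simp add: r_def)
  qed
qed

end

subsection \<open>The output law of one block\<close>

lemma cgauss_affine:
  assumes "\<tau> > 0"
  shows "distr (cgauss 0 1) borel (\<lambda>z. m + of_real \<tau> * z) = cgauss m (\<tau>\<^sup>2)"
proof (rule measure_eqI)
  fix A assume "A \<in> sets (distr (cgauss 0 1) borel (\<lambda>z. m + of_real \<tau> * z))"
  then have [measurable]: "A \<in> sets borel" by simp
  show "emeasure (distr (cgauss 0 1) borel (\<lambda>z. m + of_real \<tau> * z)) A = emeasure (cgauss m (\<tau>\<^sup>2)) A"
    using nn_integral_cgauss_affine[OF assms, of "indicator A" m]
    by (simp add: nn_integral_indicator[symmetric] nn_integral_distr del: nn_integral_indicator)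
qed simp

lemma cgauss_density_std:
  assumes "v > 0"
  shows "cgauss m v = density (cgauss 0 1) (\<lambda>z. ennreal (exp ((cmod z)\<^sup>2 - (cmod (z - m))\<^sup>2 / v) / v))"
proof -
  have "ennreal (exp (- (cmod z)\<^sup>2) / pi) * ennreal (exp ((cmod z)\<^sup>2 - (cmod (z - m))\<^sup>2 / v) / v)
      = ennreal (exp (- (cmod (z - m))\<^sup>2 / v) / (pi * v))" for z
    using assms by (simp add: ennreal_mult[symmetric] exp_add[symmetric] mult.commute)
  then show ?thesis
    unfolding cgauss_def by (subst density_density_eq) auto
qed

text \<open>With \<open>h = \<mu> + \<sigma> b\<close>, the random part
  \<open>a + \<sigma> r b\<close> is \<open>\<tau>\<close> times a unit combination of two standard
  Gaussians, where \<open>\<tau>\<^sup>2 = \<sigma>\<^sup>2 r\<^sup>2 + 1\<close>. A rotation makes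
  this combination the first coordinate, and the second integrates to 1.\<close>

lemma cgauss_convolution:
  assumes "\<sigma> > 0" and [measurable]: "\<phi> \<in> borel_measurable borel"
  shows "(\<integral>\<^sup>+h. \<integral>\<^sup>+z. \<phi> (z + h * of_real r) \<partial>cgauss 0 1 \<partial>cgauss (of_real \<mu>) (\<sigma>\<^sup>2))
    = (\<integral>\<^sup>+z. \<phi> (of_real (\<mu> * r) + of_real (sqrt (\<sigma>\<^sup>2 * r\<^sup>2 + 1)) * z) \<partial>cgauss 0 1)"
proof -
  interpret G: prob_space "cgauss 0 1" by (rule prob_space_cgauss_std)
  interpret GG: pair_sigma_finite "cgauss 0 1" "cgauss 0 1" ..
  define \<tau> where "\<tau> = sqrt (\<sigma>\<^sup>2 * r\<^sup>2 + 1)"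
  have \<tau>2: "\<tau>\<^sup>2 = \<sigma>\<^sup>2 * r\<^sup>2 + 1" by (simp add: \<tau>_def add_nonneg_nonneg)
  have \<tau>: "\<tau> > 0" unfolding \<tau>_def by (simp add: add_nonneg_pos)
  define c where "c = 1 / \<tau>"
  \<comment> \<open>The minus sign compensates the one in the first row of the rotation.\<close>
  define s where "s = complex_of_real (- (\<sigma> * r / \<tau>))"
  have cs: "c\<^sup>2 + (cmod s)\<^sup>2 = 1"
  proof -
    have "c\<^sup>2 + (cmod s)\<^sup>2 = (1 + \<sigma>\<^sup>2 * r\<^sup>2) / \<tau>\<^sup>2"
      unfolding c_def s_def norm_of_real by (simp add: power_divide power_mult_distrib add_divide_distrib)
    also have "1 + \<sigma>\<^sup>2 * r\<^sup>2 = \<tau>\<^sup>2" by (simp add: \<tau>2)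
    finally show ?thesis using \<tau> by simp
  qed
  define F where "F = (\<lambda>p::complex \<times> complex. \<phi> (of_real (\<mu> * r) + of_real \<tau> * fst p))"
  have [measurable]: "F \<in> borel_measurable (borel \<Otimes>\<^sub>M borel)"
    unfolding F_def by measurable
  have arg: "of_real \<tau> * (of_real c * a - cnj s * b) = a + of_real (\<sigma> * r) * b" for a b
    using \<tau> by (simp add: c_def s_def field_simps)
  have "(\<integral>\<^sup>+h. \<integral>\<^sup>+z. \<phi> (z + h * of_real r) \<partial>cgauss 0 1 \<partial>cgauss (of_real \<mu>) (\<sigma>\<^sup>2))
      = (\<integral>\<^sup>+b. \<integral>\<^sup>+a. \<phi> (of_real (\<mu> * r) + (a + of_real (\<sigma> * r) * b)) \<partial>cgauss 0 1 \<partial>cgauss 0 1)"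
    using assms by (subst nn_integral_cgauss_affine) (simp_all add: algebra_simps)
  also have "\<dots> = (\<integral>\<^sup>+a. \<integral>\<^sup>+b. \<phi> (of_real (\<mu> * r) + (a + of_real (\<sigma> * r) * b)) \<partial>cgauss 0 1 \<partial>cgauss 0 1)"
    by (rule GG.Fubini') (simp add: case_prod_beta)
  also have "\<dots> = (\<integral>\<^sup>+a. \<integral>\<^sup>+b. F (of_real c * a - cnj s * b, s * a + of_real c * b) \<partial>cgauss 0 1 \<partial>cgauss 0 1)"
    unfolding F_def fst_conv arg ..
  also have "\<dots> = (\<integral>\<^sup>+a. \<integral>\<^sup>+b. F (a, b) \<partial>cgauss 0 1 \<partial>cgauss 0 1)"
    by (rule cgauss_rotation[OF cs, of F]) measurable
  also have "\<dots> = (\<integral>\<^sup>+a. \<phi> (of_real (\<mu> * r) + of_real \<tau> * a) \<partial>cgauss 0 1)"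
    using G.emeasure_space_1 by (simp add: F_def)
  finally show ?thesis by (simp add: \<tau>_def)
qed

text \<open>The restriction makes the value extensional, hence a point of
  \<open>vec_space n\<close>.\<close>

definition W_shift :: "real \<Rightarrow> nat \<Rightarrow> real \<Rightarrow> (nat \<Rightarrow> complex) \<Rightarrow> nat \<Rightarrow> complex" where
  "W_shift \<kappa> n \<rho> w = (\<lambda>i\<in>{..<n}. W_tilde \<kappa> n \<rho> w i)"

text \<open>Density of the complex Gaussian law with mean
  \<open>mu_H \<kappa> * sqrt (n * \<rho>)\<close> and variance
  \<open>sigma2_H \<kappa> * n * \<rho> + 1\<close> relative to the standard one.\<close>

definition axis_ratio :: "real \<Rightarrow> nat \<Rightarrow> real \<Rightarrow> complex \<Rightarrow> real" where
  "axis_ratio \<kappa> n \<rho> z =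
     exp ((cmod z)\<^sup>2 - (cmod (z - of_real (mu_H \<kappa> * sqrt (real n * \<rho>))))\<^sup>2 / (sigma2_H \<kappa> * real n * \<rho> + 1))
     / (sigma2_H \<kappa> * real n * \<rho> + 1)"

text \<open>Where the Bessel integral is positive, this is the logarithm of
  \<open>axis_ratio\<close> over \<open>mix_density\<close>, written in terms of the output
  alone.\<close>

definition info_density :: "real \<Rightarrow> nat \<Rightarrow> real \<Rightarrow> (nat \<Rightarrow> complex) \<Rightarrow> real" where
  "info_density \<kappa> n \<rho> y =
     - ln ((1 + sigma2_H \<kappa> * real n * \<rho>) / sigma2_H \<kappa>) - ln (Gamma (real n))
     + ((cmod (y 0))\<^sup>2 - (cmod (y 0 - of_real (mu_H \<kappa> * sqrt (real n * \<rho>))))\<^sup>2 / (sigma2_H \<kappa> * real n * \<rho> + 1))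
     + \<bar>mu_H \<kappa>\<bar>\<^sup>2 / sigma2_H \<kappa> - ln (mix_integral \<kappa> n \<rho> (vnorm n y))"

text \<open>The output law of one block when the whole power is put into the first entry of the input.\<close>

definition axis_law :: "real \<Rightarrow> nat \<Rightarrow> real \<Rightarrow> (nat \<Rightarrow> complex) measure" where
  "axis_law \<kappa> n \<rho> = distr (cgauss_vec n) (vec_space n) (W_shift \<kappa> n \<rho>)"

lemma measurable_W_shift [measurable]: "W_shift \<kappa> n \<rho> \<in> vec_space n \<rightarrow>\<^sub>M vec_space n"
  unfolding W_shift_def[abs_def] W_tilde_def vec_space_def by measurable

lemma sets_axis_law [simp, measurable_cong]: "sets (axis_law \<kappa> n \<rho>) = sets (vec_space n)"
  by (simp add: axis_law_def)

lemma prob_space_axis_law: "prob_space (axis_law \<kappa> n \<rho>)"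
  unfolding axis_law_def
  by (intro prob_space.prob_space_distr prob_space_cgauss_vec) simp

lemma measurable_axis_ratio [measurable]: "axis_ratio \<kappa> n \<rho> \<in> borel_measurable borel"
  unfolding axis_ratio_def[abs_def] by measurable

context
  fixes n :: nat and \<kappa> \<rho> :: real
  assumes n: "n \<ge> 1" and \<kappa>: "\<kappa> \<ge> 0" and \<rho>: "\<rho> > 0"
begin

lemma var_pos: "sigma2_H \<kappa> * real n * \<rho> + 1 > 0"
  using n \<rho> sigma2_H_pos[OF \<kappa>] by (simp add: add_nonneg_pos)

text \<open>The shift alters only coordinate 0, so the difference of squared norms lives there. The
  output determines \<open>|w 0|^2\<close> as its squared distance from the mean over the
  variance.\<close>

lemma S1_eq_info_density: "S1 \<kappa> n \<rho> w = info_density \<kappa> n \<rho> (W_shift \<kappa> n \<rho> w)"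
proof -
  let ?v = "sigma2_H \<kappa> * real n * \<rho> + 1"
  let ?m = "complex_of_real (mu_H \<kappa> * sqrt (real n * \<rho>))"
  let ?y = "W_shift \<kappa> n \<rho> w"
  have y0: "?y 0 = ?m + of_real (sqrt ?v) * w 0"
    using n by (simp add: W_shift_def W_tilde_def)
  have yi: "?y i = w i" if "i < n" "i \<noteq> 0" for i
    using that by (simp add: W_shift_def W_tilde_def)
  have split: "(\<Sum>i<n. h i) = h 0 + (\<Sum>i\<in>{..<n} - {0}. h i)" for h :: "nat \<Rightarrow> real"
    using n by (intro sum.remove) auto
  have "(\<Sum>i\<in>{..<n} - {0}. (cmod (?y i))\<^sup>2) = (\<Sum>i\<in>{..<n} - {0}. (cmod (w i))\<^sup>2)"
    by (intro sum.cong) (auto simp: yi)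
  then have "(vnorm n w)\<^sup>2 - (vnorm n ?y)\<^sup>2 = (cmod (w 0))\<^sup>2 - (cmod (?y 0))\<^sup>2"
    unfolding vnorm_sq split[of "\<lambda>i. (cmod (?y i))\<^sup>2"] split[of "\<lambda>i. (cmod (w i))\<^sup>2"] by simp
  moreover have "(cmod (?y 0 - ?m))\<^sup>2 / ?v = (cmod (w 0))\<^sup>2"
    using var_pos by (simp add: y0 norm_mult power_mult_distrib)
  moreover have "vnorm n (W_tilde \<kappa> n \<rho> w) = vnorm n ?y"
    unfolding vnorm_def by (intro L2_set_cong) (auto simp: W_shift_def)
  ultimately show ?thesis
    unfolding S1_def info_density_def Let_def mix_integral_def mix_integrand_def by simp
qed

lemma axis_law_density:
  "axis_law \<kappa> n \<rho> = density (cgauss_vec n) (\<lambda>y. ennreal (axis_ratio \<kappa> n \<rho> (y 0)))"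
proof -
  define v where "v = sigma2_H \<kappa> * real n * \<rho> + 1"
  define m where "m = complex_of_real (mu_H \<kappa> * sqrt (real n * \<rho>))"
  have v: "v > 0" using var_pos by (simp add: v_def)
  \<comment> \<open>Only coordinate 0 changes its law, so all other factors have density 1.\<close>
  define g where "g = (\<lambda>i::nat. if i = 0 then (\<lambda>z. ennreal (axis_ratio \<kappa> n \<rho> z)) else (\<lambda>_. 1))"
  have [measurable]: "g i \<in> borel_measurable borel" for i
    by (simp add: g_def)
  have comp: "distr (cgauss 0 1) borel (\<lambda>z. (if i = 0 then m else 0) + of_real (if i = 0 then sqrt v else 1) * z)
      = density (cgauss 0 1) (g i)" for i :: nat
  proof (cases "i = 0")
    case True
    then show ?thesis
      using cgauss_affine[of "sqrt v" m] v cgauss_density_std[OF v, of m]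
      by (simp add: g_def axis_ratio_def v_def m_def)
  next
    case False
    then show ?thesis
      using cgauss_affine[of 1 0] by (simp add: g_def density_1)
  qed
  have "axis_law \<kappa> n \<rho> = distr (\<Pi>\<^sub>M i\<in>{..<n}. cgauss 0 1) (\<Pi>\<^sub>M i\<in>{..<n}. borel)
      (\<lambda>w. \<lambda>i\<in>{..<n}. (if i = 0 then m else 0) + of_real (if i = 0 then sqrt v else 1) * w i)"
    unfolding axis_law_def cgauss_vec_def vec_space_def
    by (intro distr_cong refl) (auto simp: W_shift_def W_tilde_def m_def v_def fun_eq_iff)
  also have "\<dots> = (\<Pi>\<^sub>M i\<in>{..<n}. density (cgauss 0 1) (g i))"
    by (subst distr_PiM_components) (auto simp: comp prob_space_cgauss_std)
  also have "\<dots> = density (\<Pi>\<^sub>M i\<in>{..<n}. cgauss 0 1) (\<lambda>y. \<Prod>i<n. g i (y i))"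
  proof (rule PiM_density)
    fix i :: nat
    show "prob_space (density (cgauss 0 1) (g i))"
      unfolding comp[symmetric] by (intro prob_space.prob_space_distr prob_space_cgauss_std) simp
  qed (auto intro: prob_space_imp_sigma_finite prob_space_cgauss_std)
  also have "(\<lambda>y. \<Prod>i<n. g i (y i)) = (\<lambda>y. ennreal (axis_ratio \<kappa> n \<rho> (y 0)))"
  proof
    fix y :: "nat \<Rightarrow> complex"
    have "(\<Prod>i<n. g i (y i)) = (\<Prod>i\<in>{0}. g i (y i))"
      using n by (intro prod.mono_neutral_right) (auto simp: g_def)
    then show "(\<Prod>i<n. g i (y i)) = ennreal (axis_ratio \<kappa> n \<rho> (y 0))"
      by (simp add: g_def)
  qed
  finally show ?thesis by (simp add: cgauss_vec_def)
qed

text \<open>Positivity of the integral \<open>J\<close> is what lets \<open>exp (- ln J)\<close>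
  cancel the factor \<open>J\<close> of \<open>mix_density\<close>.\<close>

lemma axis_ratio_eq:
  assumes "mix_integral \<kappa> n \<rho> (vnorm n y) > 0"
  shows "axis_ratio \<kappa> n \<rho> (y 0) = exp (info_density \<kappa> n \<rho> y) * mix_density \<kappa> n \<rho> y"
proof -
  have pos: "Gamma (real n) > 0" "sigma2_H \<kappa> > 0" "1 + sigma2_H \<kappa> * real n * \<rho> > 0"
    using n sigma2_H_pos[OF \<kappa>] var_pos by (auto intro!: Gamma_real_pos simp: add.commute)
  have "exp (- ln (A / S) - ln G + E + Q - ln J) = exp E / A * S / G * exp Q / J"
    if "A > 0" "S > 0" "G > 0" "J > 0" for A S G E Q J :: real
    using that by (simp add: exp_add exp_diff exp_minus)
  note this[OF pos(3,2,1) assms]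
  then show ?thesis
    using assms pos
    by (simp add: info_density_def axis_ratio_def mix_density_def exp_minus add.commute[of 1])
qed

lemma info_density_measurable [measurable]: "info_density \<kappa> n \<rho> \<in> borel_measurable (vec_space n)"
proof -
  have [measurable]: "(\<lambda>y. y 0) \<in> borel_measurable (vec_space n)"
    using n by (intro measurable_vec_component) simp
  note mix_integral_measurable[OF n \<kappa> \<rho>, measurable]
  show ?thesis
    unfolding info_density_def[abs_def] by measurable
qed

text \<open>The noise may be replaced by its image under \<open>U\<close>, and
  \<open>x = U e\<close> with \<open>e\<close> on the first axis; linearity then pulls
  \<open>U\<close> out of the output. In \<open>h e + w\<close> the fading touches only coordinate
  0, where it merges with the noise into one Gaussian.\<close>

lemma channel_block:
  assumes x: "x \<in> space (vec_space n)" "(vnorm n x)\<^sup>2 = real n * \<rho>" and U: "unitary_map n U"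
    and Ux: "U (\<lambda>i\<in>{..<n}. if i = 0 then of_real (vnorm n x) else 0) = x"
  shows "distr (cgauss (of_real (mu_H \<kappa>)) (sigma2_H \<kappa>) \<Otimes>\<^sub>M cgauss_vec n) (vec_space n)
      (\<lambda>p. \<lambda>i\<in>{..<n}. fst p * x i + snd p i)
    = distr (axis_law \<kappa> n \<rho>) (vec_space n) U"
proof (rule measure_eqI)
  let ?F = "cgauss (of_real (mu_H \<kappa>)) (sigma2_H \<kappa>)" and ?N = "cgauss_vec n"
  let ?P = "PiM {1..<n} (\<lambda>_. cgauss 0 1)"
  define r where "r = vnorm n x"
  define e where "e = (\<lambda>i\<in>{..<n}. if i = 0 then complex_of_real r else 0)"
  define \<sigma> where "\<sigma> = sqrt (sigma2_H \<kappa>)"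
  have \<sigma>: "\<sigma> > 0" "\<sigma>\<^sup>2 = sigma2_H \<kappa>"
    using sigma2_H_pos[OF \<kappa>] by (auto simp: \<sigma>_def)
  have r: "r = sqrt (real n * \<rho>)" "r\<^sup>2 = real n * \<rho>"
    using x(2) real_sqrt_unique[of r "real n * \<rho>"] by (auto simp: r_def)
  have e: "e \<in> space (vec_space n)"
    by (simp add: e_def space_vec_space)
  have Ue: "U e = x"
    using Ux unfolding e_def r_def .
  have U_meas [measurable]: "U \<in> vec_space n \<rightarrow>\<^sub>M vec_space n"
    using U by (simp add: unitary_map_def)
  have "prob_space ?F" using sigma2_H_pos[OF \<kappa>] by (rule prob_space_cgauss)
  then interpret F: prob_space ?F .
  interpret N: prob_space ?N by (rule prob_space_cgauss_vec)
  interpret P: prob_space ?P by (intro prob_space_PiM prob_space_cgauss_std)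
  interpret FP: pair_sigma_finite ?F ?P ..
  have I: "{..<n} = insert 0 {1..<n}" using n by auto
  have sets_P: "sets (PiM {..<n} (\<lambda>_. cgauss 0 1)) = sets (vec_space n)"
    using sets_cgauss_vec[of n] by (simp add: cgauss_vec_def)
  have lin: "(\<lambda>w. \<lambda>i\<in>{..<n}. w i + h * y i) \<in> vec_space n \<rightarrow>\<^sub>M vec_space n" for h y
    unfolding vec_space_def by measurable
  have out: "(\<lambda>p. \<lambda>i\<in>{..<n}. fst p * x i + snd p i) \<in> ?F \<Otimes>\<^sub>M ?N \<rightarrow>\<^sub>M vec_space n"
    unfolding vec_space_def cgauss_vec_def by measurable
  have split: "(\<integral>\<^sup>+w. k w \<partial>?N) = (\<integral>\<^sup>+y. \<integral>\<^sup>+z. k (y(0 := z)) \<partial>cgauss 0 1 \<partial>?P)"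
    if "k \<in> borel_measurable (vec_space n)" for k
  proof -
    have "k \<in> borel_measurable (PiM (insert 0 {1..<n}) (\<lambda>_. cgauss 0 1))"
      using that unfolding measurable_cong_sets[OF sets_P refl, symmetric] I .
    then show ?thesis
      unfolding cgauss_vec_def I by (intro std.product_nn_integral_insert) auto
  qed
  fix A assume "A \<in> sets (distr (?F \<Otimes>\<^sub>M ?N) (vec_space n) (\<lambda>p. \<lambda>i\<in>{..<n}. fst p * x i + snd p i))"
  then have A [measurable]: "A \<in> sets (vec_space n)" by simp
  define g where "g = (\<lambda>y. indicator A (U y) :: ennreal)"
  have g [measurable]: "g \<in> borel_measurable (vec_space n)"
    unfolding g_def by measurable
  have upd: "(\<lambda>q. g ((snd (fst q))(0 := snd q + fst (fst q) * of_real r))) \<in> borel_measurable ((?F \<Otimes>\<^sub>M ?P) \<Otimes>\<^sub>M cgauss 0 1)"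
  proof -
    have "(\<lambda>q. (snd (fst q))(0 := snd q + fst (fst q) * of_real r)) \<in> (?F \<Otimes>\<^sub>M ?P) \<Otimes>\<^sub>M cgauss 0 1 \<rightarrow>\<^sub>M PiM {..<n} (\<lambda>_. cgauss 0 1)"
      unfolding I by (rule measurable_fun_upd[where J = "{1..<n}"]) auto
    then have "(\<lambda>q. (snd (fst q))(0 := snd q + fst (fst q) * of_real r)) \<in> (?F \<Otimes>\<^sub>M ?P) \<Otimes>\<^sub>M cgauss 0 1 \<rightarrow>\<^sub>M vec_space n"
      unfolding measurable_cong_sets[OF refl sets_P] .
    from measurable_compose[OF this g] show ?thesis .
  qed
  have upd1: "(\<lambda>z. g (y(0 := z))) \<in> borel_measurable borel" if "y \<in> space ?P" for y
  proof -
    have "(\<lambda>z. y(0 := z)) \<in> borel \<rightarrow>\<^sub>M PiM {..<n} (\<lambda>_. cgauss 0 1)"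
      unfolding I using that by (intro measurable_fun_upd[where J = "{1..<n}"] measurable_const) auto
    then have "(\<lambda>z. y(0 := z)) \<in> borel \<rightarrow>\<^sub>M vec_space n"
      unfolding measurable_cong_sets[OF refl sets_P] .
    from measurable_compose[OF this g] show ?thesis .
  qed
  have "emeasure (distr (?F \<Otimes>\<^sub>M ?N) (vec_space n) (\<lambda>p. \<lambda>i\<in>{..<n}. fst p * x i + snd p i)) A
      = (\<integral>\<^sup>+p. indicator A (\<lambda>i\<in>{..<n}. fst p * x i + snd p i) \<partial>(?F \<Otimes>\<^sub>M ?N))"
    using out by (simp add: nn_integral_indicator[symmetric] nn_integral_distr del: nn_integral_indicator)
  also have "\<dots> = (\<integral>\<^sup>+h. \<integral>\<^sup>+w. indicator A (\<lambda>i\<in>{..<n}. h * x i + w i) \<partial>?N \<partial>?F)"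
    using measurable_compose[OF out borel_measurable_indicator[OF A]]
    by (subst N.nn_integral_fst[symmetric]) simp_all
  also have "\<dots> = (\<integral>\<^sup>+h. \<integral>\<^sup>+w. g (\<lambda>i\<in>{..<n}. w i + h * e i) \<partial>?N \<partial>?F)"
  proof (rule nn_integral_cong)
    fix h
    have "(\<integral>\<^sup>+w. indicator A (\<lambda>i\<in>{..<n}. h * x i + w i) \<partial>?N)
        = (\<integral>\<^sup>+w. indicator A (\<lambda>i\<in>{..<n}. w i + h * x i) \<partial>distr ?N (vec_space n) U)"
      using U by (simp add: unitary_map_def add.commute)
    also have "\<dots> = (\<integral>\<^sup>+w. indicator A (\<lambda>i\<in>{..<n}. U w i + h * x i) \<partial>?N)"
      using measurable_compose[OF lin borel_measurable_indicator[OF A]]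
      by (intro nn_integral_distr) auto
    also have "\<dots> = (\<integral>\<^sup>+w. g (\<lambda>i\<in>{..<n}. w i + h * e i) \<partial>?N)"
    proof (rule nn_integral_cong)
      fix w assume "w \<in> space ?N"
      then have "U (\<lambda>i\<in>{..<n}. w i + h * e i) = (\<lambda>i\<in>{..<n}. U w i + h * U e i)"
        using U e unfolding unitary_map_def by simp
      then show "indicator A (\<lambda>i\<in>{..<n}. U w i + h * x i) = g (\<lambda>i\<in>{..<n}. w i + h * e i)"
        by (simp only: g_def Ue)
    qed
    finally show "(\<integral>\<^sup>+w. indicator A (\<lambda>i\<in>{..<n}. h * x i + w i) \<partial>?N)
        = (\<integral>\<^sup>+w. g (\<lambda>i\<in>{..<n}. w i + h * e i) \<partial>?N)" .
  qed
  also have "\<dots> = (\<integral>\<^sup>+h. \<integral>\<^sup>+y. \<integral>\<^sup>+z. g (y(0 := z + h * of_real r)) \<partial>cgauss 0 1 \<partial>?P \<partial>?F)"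
  proof (rule nn_integral_cong)
    fix h
    have "(\<integral>\<^sup>+w. g (\<lambda>i\<in>{..<n}. w i + h * e i) \<partial>?N)
        = (\<integral>\<^sup>+y. \<integral>\<^sup>+z. g (\<lambda>i\<in>{..<n}. (y(0 := z)) i + h * e i) \<partial>cgauss 0 1 \<partial>?P)"
      by (rule split[OF measurable_compose[OF lin g]])
    also have "\<dots> = (\<integral>\<^sup>+y. \<integral>\<^sup>+z. g (y(0 := z + h * of_real r)) \<partial>cgauss 0 1 \<partial>?P)"
    proof (intro nn_integral_cong arg_cong[where f = g])
      fix y z assume "y \<in> space ?P"
      then show "(\<lambda>i\<in>{..<n}. (y(0 := z)) i + h * e i) = y(0 := z + h * of_real r)"
        using n by (auto simp: fun_eq_iff e_def space_PiM PiE_iff extensional_def)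
    qed
    finally show "(\<integral>\<^sup>+w. g (\<lambda>i\<in>{..<n}. w i + h * e i) \<partial>?N)
        = (\<integral>\<^sup>+y. \<integral>\<^sup>+z. g (y(0 := z + h * of_real r)) \<partial>cgauss 0 1 \<partial>?P)" .
  qed
  \<comment> \<open>The fading is moved next to coordinate 0, so that
    \<open>cgauss_convolution\<close> applies with the remaining coordinates fixed.\<close>
  also have "\<dots> = (\<integral>\<^sup>+y. \<integral>\<^sup>+h. \<integral>\<^sup>+z. g (y(0 := z + h * of_real r)) \<partial>cgauss 0 1 \<partial>?F \<partial>?P)"
  proof (rule FP.Fubini'[symmetric])
    show "(\<lambda>(h, y). \<integral>\<^sup>+z. g (y(0 := z + h * of_real r)) \<partial>cgauss 0 1) \<in> borel_measurable (?F \<Otimes>\<^sub>M ?P)"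
      unfolding case_prod_beta
      by (rule sigma_finite_measure.borel_measurable_nn_integral[OF prob_space_imp_sigma_finite[OF prob_space_cgauss_std]]) (use upd in \<open>simp add: case_prod_beta\<close>)
  qed
  also have "\<dots> = (\<integral>\<^sup>+y. \<integral>\<^sup>+z. g (y(0 := of_real (mu_H \<kappa> * r) + of_real (sqrt (sigma2_H \<kappa> * r\<^sup>2 + 1)) * z)) \<partial>cgauss 0 1 \<partial>?P)"
    using cgauss_convolution[OF \<sigma>(1) upd1] by (intro nn_integral_cong) (simp add: \<sigma>(2))
  also have "\<dots> = (\<integral>\<^sup>+y. \<integral>\<^sup>+z. g (W_shift \<kappa> n \<rho> (y(0 := z))) \<partial>cgauss 0 1 \<partial>?P)"
  proof (intro nn_integral_cong arg_cong[where f = g])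
    fix y z assume "y \<in> space ?P"
    then show "y(0 := of_real (mu_H \<kappa> * r) + of_real (sqrt (sigma2_H \<kappa> * r\<^sup>2 + 1)) * z) = W_shift \<kappa> n \<rho> (y(0 := z))"
      using n unfolding r(2)
      by (auto simp: fun_eq_iff W_shift_def W_tilde_def r(1) space_PiM PiE_iff extensional_def mult.assoc)
  qed
  also have "\<dots> = (\<integral>\<^sup>+w. g (W_shift \<kappa> n \<rho> w) \<partial>?N)"
    by (rule split[symmetric]) measurable
  also have "\<dots> = emeasure (distr (axis_law \<kappa> n \<rho>) (vec_space n) U) A"
    by (simp add: g_def axis_law_def nn_integral_indicator[symmetric] nn_integral_distr del: nn_integral_indicator)
  finally show "emeasure (distr (?F \<Otimes>\<^sub>M ?N) (vec_space n) (\<lambda>p. \<lambda>i\<in>{..<n}. fst p * x i + snd p i)) A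
      = emeasure (distr (axis_law \<kappa> n \<rho>) (vec_space n) U) A" .
qed simp

end

subsection \<open>The converse bound\<close>

lemma sets_noise_law [simp, measurable_cong]: "sets (noise_law l n) = sets (block_space l n)"
  unfolding noise_law_def block_space_def by (intro sets_PiM_cong) auto

lemma space_noise_law [simp]: "space (noise_law l n) = space (block_space l n)"
  by (rule sets_eq_imp_space_eq) simp

lemma measurable_block: "k < l \<Longrightarrow> (\<lambda>y. y k) \<in> block_space l n \<rightarrow>\<^sub>M vec_space n"
  unfolding block_space_def by measurable

definition axis_block_law :: "real \<Rightarrow> nat \<Rightarrow> nat \<Rightarrow> real \<Rightarrow> (nat \<Rightarrow> nat \<Rightarrow> complex) measure" where
  "axis_block_law \<kappa> l n \<rho> = (\<Pi>\<^sub>M k\<in>{..<l}. axis_law \<kappa> n \<rho>)"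

lemma sets_axis_block_law [simp, measurable_cong]:
  "sets (axis_block_law \<kappa> l n \<rho>) = sets (block_space l n)"
  unfolding axis_block_law_def block_space_def by (intro sets_PiM_cong) auto

lemma space_axis_block_law [simp]: "space (axis_block_law \<kappa> l n \<rho>) = space (block_space l n)"
  by (rule sets_eq_imp_space_eq) simp

lemma prob_space_axis_block_law: "prob_space (axis_block_law \<kappa> l n \<rho>)"
  unfolding axis_block_law_def by (intro prob_space_PiM prob_space_axis_law)

lemma distr_W_shift_noise_law:
  "distr (noise_law l n) (block_space l n) (\<lambda>W. \<lambda>k\<in>{..<l}. W_shift \<kappa> n \<rho> (W k)) = axis_block_law \<kappa> l n \<rho>"
  unfolding noise_law_def block_space_def axis_block_law_def axis_law_def
  by (rule distr_PiM_components) (auto intro: prob_space_cgauss_vec)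

context
  fixes l n :: nat and \<kappa> \<rho> :: real
  assumes n: "n \<ge> 1" and \<kappa>: "\<kappa> \<ge> 0" and \<rho>: "\<rho> > 0"
begin

lemma axis_block_law_density:
  "axis_block_law \<kappa> l n \<rho> = density (noise_law l n) (\<lambda>y. \<Prod>k<l. ennreal (axis_ratio \<kappa> n \<rho> (y k 0)))"
  unfolding axis_block_law_def noise_law_def axis_law_density[OF n \<kappa> \<rho>]
proof (rule PiM_density)
  show "(\<lambda>y. ennreal (axis_ratio \<kappa> n \<rho> (y 0))) \<in> borel_measurable (cgauss_vec n)"
    using measurable_compose[OF measurable_vec_component measurable_axis_ratio, of 0 n] n by simp
  show "prob_space (density (cgauss_vec n) (\<lambda>y. ennreal (axis_ratio \<kappa> n \<rho> (y 0))))"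
    unfolding axis_law_density[OF n \<kappa> \<rho>, symmetric] by (rule prob_space_axis_law)
qed (auto intro: prob_space_imp_sigma_finite prob_space_cgauss_vec)

lemma measurable_block_mix_density [measurable]:
  "(\<lambda>y. \<Prod>k<l. ennreal (mix_density \<kappa> n \<rho> (y k))) \<in> borel_measurable (block_space l n)"
  using measurable_compose[OF measurable_block mix_density_measurable[OF n \<kappa> \<rho>]]
  by (intro borel_measurable_prod_ennreal measurable_compose[OF _ measurable_ennreal]) auto

text \<open>Each block is rotated by its own unitary, and a product of image laws is the image of
  the product. \<open>T\<close> depends on the codeword but preserves \<open>Q\<close>: it fixes the
  noise law and the norms on which the density depends.\<close>

lemma channel_law_rotate:
  assumes x: "x \<in> space (block_space l n)" and norm: "\<And>k. k < l \<Longrightarrow> (vnorm n (x k))\<^sup>2 = real n * \<rho>"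
  obtains T where "T \<in> block_space l n \<rightarrow>\<^sub>M block_space l n"
    and "channel_law \<kappa> l n x = distr (axis_block_law \<kappa> l n \<rho>) (block_space l n) T"
    and "distr (noise_law l n) (block_space l n) T = noise_law l n"
    and "\<And>y. y \<in> space (block_space l n) \<Longrightarrow>
      (\<Prod>k<l. ennreal (mix_density \<kappa> n \<rho> (T y k))) = (\<Prod>k<l. ennreal (mix_density \<kappa> n \<rho> (y k)))"
proof -
  have xk: "x k \<in> space (vec_space n)" if "k < l" for k
    using measurable_space[OF measurable_block[OF that] x] .
  have "\<forall>k\<in>{..<l}. \<exists>U. unitary_map n U \<and> U (\<lambda>i\<in>{..<n}. if i = 0 then of_real (vnorm n (x k)) else 0) = x k"
    using ex_unitary_map_axis[OF xk n] by blast
  then obtain U where U: "\<And>k. k < l \<Longrightarrow> unitary_map n (U k)"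
      "\<And>k. k < l \<Longrightarrow> U k (\<lambda>i\<in>{..<n}. if i = 0 then of_real (vnorm n (x k)) else 0) = x k"
    by (auto dest!: bchoice)
  have Um: "U k \<in> vec_space n \<rightarrow>\<^sub>M vec_space n" if "k < l" for k
    using U(1)[OF that] by (simp add: unitary_map_def)
  define T where "T = (\<lambda>y. \<lambda>k\<in>{..<l}. U k (y k))"
  let ?F = "cgauss (of_real (mu_H \<kappa>)) (sigma2_H \<kappa>)"
  show thesis
  proof (rule that[of T])
    show "T \<in> block_space l n \<rightarrow>\<^sub>M block_space l n"
      unfolding T_def block_space_def
      by (intro measurable_restrict measurable_compose[OF measurable_component_singleton] Um) auto
    have prob: "prob_space (?F \<Otimes>\<^sub>M cgauss_vec n)"
    proof -
      interpret F: prob_space ?F by (rule prob_space_cgauss[OF sigma2_H_pos[OF \<kappa>]])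
      interpret N: prob_space "cgauss_vec n" by (rule prob_space_cgauss_vec)
      interpret pair_prob_space ?F "cgauss_vec n" ..
      show ?thesis by (rule prob_space_axioms)
    qed
    have out: "(\<lambda>p. \<lambda>i\<in>{..<n}. fst p * x k i + snd p i) \<in> ?F \<Otimes>\<^sub>M cgauss_vec n \<rightarrow>\<^sub>M vec_space n" for k
      unfolding vec_space_def cgauss_vec_def by measurable
    have "channel_law \<kappa> l n x
        = (\<Pi>\<^sub>M k\<in>{..<l}. distr (?F \<Otimes>\<^sub>M cgauss_vec n) (vec_space n) (\<lambda>p. \<lambda>i\<in>{..<n}. fst p * x k i + snd p i))"
      unfolding channel_law_def fading_noise_law_def block_space_def
      by (rule distr_PiM_components) (rule finite_lessThan, rule prob, rule out)
    also have "\<dots> = (\<Pi>\<^sub>M k\<in>{..<l}. distr (axis_law \<kappa> n \<rho>) (vec_space n) (U k))"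
      using channel_block[OF n \<kappa> \<rho> xk norm U] by (intro PiM_cong) auto
    also have "\<dots> = distr (axis_block_law \<kappa> l n \<rho>) (block_space l n) T"
      unfolding axis_block_law_def block_space_def T_def
      by (rule distr_PiM_components[symmetric]) (auto intro: prob_space_axis_law simp: Um measurable_cong_sets[OF sets_axis_law refl])
    finally show "channel_law \<kappa> l n x = distr (axis_block_law \<kappa> l n \<rho>) (block_space l n) T" .
    have "distr (noise_law l n) (block_space l n) T = (\<Pi>\<^sub>M k\<in>{..<l}. distr (cgauss_vec n) (vec_space n) (U k))"
      unfolding noise_law_def block_space_def T_def
      by (rule distr_PiM_components) (auto intro: prob_space_cgauss_vec simp: Um measurable_cong_sets[OF sets_cgauss_vec refl])
    also have "\<dots> = noise_law l n"
      unfolding noise_law_def using U(1) by (intro PiM_cong) (auto simp: unitary_map_def)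
    finally show "distr (noise_law l n) (block_space l n) T = noise_law l n" .
    fix y assume y: "y \<in> space (block_space l n)"
    have "vnorm n (T y k) = vnorm n (y k)" if "k < l" for k
      using U(1)[OF that] measurable_space[OF measurable_block[OF that] y] that
      by (simp add: T_def unitary_map_def)
    then show "(\<Prod>k<l. ennreal (mix_density \<kappa> n \<rho> (T y k))) = (\<Prod>k<l. ennreal (mix_density \<kappa> n \<rho> (y k)))"
      by (intro prod.cong) (auto simp: mix_density_def)
  qed
qed

definition low_info :: "real \<Rightarrow> (nat \<Rightarrow> nat \<Rightarrow> complex) set" where
  "low_info lam = {y \<in> space (block_space l n). (\<Sum>k<l. info_density \<kappa> n \<rho> (y k)) \<le> lam}"

lemma low_info_measurable [measurable]: "low_info lam \<in> sets (block_space l n)"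
proof -
  have [measurable]: "(\<lambda>y. \<Sum>k<l. info_density \<kappa> n \<rho> (y k)) \<in> borel_measurable (block_space l n)"
    using measurable_compose[OF measurable_block info_density_measurable[OF n \<kappa> \<rho>]]
    by (intro borel_measurable_sum) auto
  show ?thesis unfolding low_info_def by measurable
qed

lemma prob_low_info:
  "measure (axis_block_law \<kappa> l n \<rho>) (low_info lam)
    = \<P>(W in noise_law l n. (\<Sum>k<l. S1 \<kappa> n \<rho> (W k)) \<le> lam)"
proof -
  let ?V = "\<lambda>W. \<lambda>k\<in>{..<l}. W_shift \<kappa> n \<rho> (W k)"
  have V: "?V \<in> noise_law l n \<rightarrow>\<^sub>M block_space l n"
    unfolding noise_law_def block_space_def
    by (intro measurable_restrict measurable_compose[OF measurable_component_singleton]) auto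
  have "?V -` low_info lam \<inter> space (noise_law l n)
      = {W \<in> space (noise_law l n). (\<Sum>k<l. S1 \<kappa> n \<rho> (W k)) \<le> lam}"
    using measurable_space[OF V] by (auto simp: low_info_def S1_eq_info_density[OF n \<kappa> \<rho>])
  then show ?thesis
    unfolding distr_W_shift_noise_law[symmetric] using V by (simp add: measure_distr)
qed

text \<open>Change of measure: on \<open>low_info lam\<close> the likelihood ratio is at most
  \<open>exp lam\<close>, outside the null set where some block has a vanishing Bessel
  integral.\<close>

lemma emeasure_low_info_le:
  assumes [measurable]: "B \<in> sets (block_space l n)"
  shows "emeasure (axis_block_law \<kappa> l n \<rho>) (B \<inter> low_info lam)
    \<le> ennreal (exp lam) * (\<integral>\<^sup>+y. (\<Prod>k<l. ennreal (mix_density \<kappa> n \<rho> (y k))) * indicator B y \<partial>noise_law l n)"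
proof -
  have ratio [measurable]: "(\<lambda>y. \<Prod>k<l. ennreal (axis_ratio \<kappa> n \<rho> (y k 0))) \<in> borel_measurable (block_space l n)"
    using measurable_compose[OF measurable_block measurable_compose[OF measurable_vec_component measurable_axis_ratio], of _ l 0 n] n
    by (intro borel_measurable_prod_ennreal measurable_compose[OF _ measurable_ennreal]) auto
  have "AE y in noise_law l n. \<forall>k\<in>{..<l}. mix_integral \<kappa> n \<rho> (vnorm n (y k)) > 0"
  proof (rule AE_ball_countable')
    fix k assume "k \<in> {..<l}"
    then show "AE y in noise_law l n. mix_integral \<kappa> n \<rho> (vnorm n (y k)) > 0"
      unfolding noise_law_def
      by (intro AE_PiM_component[where P = "\<lambda>v. mix_integral \<kappa> n \<rho> (vnorm n v) > 0"]
          prob_space_cgauss_vec AE_mix_integral_pos[OF n \<kappa> \<rho>])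
  qed simp
  then have "(\<integral>\<^sup>+y. (\<Prod>k<l. ennreal (axis_ratio \<kappa> n \<rho> (y k 0))) * indicator (B \<inter> low_info lam) y \<partial>noise_law l n)
      \<le> (\<integral>\<^sup>+y. ennreal (exp lam) * ((\<Prod>k<l. ennreal (mix_density \<kappa> n \<rho> (y k))) * indicator B y) \<partial>noise_law l n)"
  proof (intro nn_integral_mono_AE, eventually_elim)
    case (elim y)
    show ?case
    proof (cases "y \<in> B \<inter> low_info lam")
      case True
      have "(\<Prod>k<l. ennreal (axis_ratio \<kappa> n \<rho> (y k 0)))
          = ennreal (\<Prod>k<l. exp (info_density \<kappa> n \<rho> (y k)) * mix_density \<kappa> n \<rho> (y k))"
        using elim by (subst prod_ennreal[symmetric])
          (auto simp: axis_ratio_eq[OF n \<kappa> \<rho>] mix_density_nonneg[OF n \<kappa> \<rho>] intro!: prod.cong)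
      also have "(\<Prod>k<l. exp (info_density \<kappa> n \<rho> (y k)) * mix_density \<kappa> n \<rho> (y k))
          = exp (\<Sum>k<l. info_density \<kappa> n \<rho> (y k)) * (\<Prod>k<l. mix_density \<kappa> n \<rho> (y k))"
        by (simp add: prod.distrib exp_sum)
      also have "\<dots> \<le> exp lam * (\<Prod>k<l. mix_density \<kappa> n \<rho> (y k))"
        using True by (intro mult_right_mono prod_nonneg)
          (auto simp: low_info_def mix_density_nonneg[OF n \<kappa> \<rho>])
      finally have "(\<Prod>k<l. ennreal (axis_ratio \<kappa> n \<rho> (y k 0)))
          \<le> ennreal (exp lam * (\<Prod>k<l. mix_density \<kappa> n \<rho> (y k)))"
        by (simp add: ennreal_leI)
      also have "\<dots> = ennreal (exp lam) * (\<Prod>k<l. ennreal (mix_density \<kappa> n \<rho> (y k)))"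
        by (simp add: ennreal_mult' prod_ennreal mix_density_nonneg[OF n \<kappa> \<rho>])
      finally show ?thesis using True by simp
    qed simp
  qed
  then show ?thesis
    unfolding axis_block_law_density
    by (simp add: emeasure_density nn_integral_cmult)
qed

lemma nn_integral_block_mix_density:
  "(\<integral>\<^sup>+y. (\<Prod>k<l. ennreal (mix_density \<kappa> n \<rho> (y k))) \<partial>noise_law l n) \<le> 1"
proof -
  interpret product_sigma_finite "\<lambda>_::nat. cgauss_vec n"
    by (rule product_sigma_finite.intro) (rule prob_space_imp_sigma_finite[OF prob_space_cgauss_vec])
  have "(\<integral>\<^sup>+y. (\<Prod>k<l. ennreal (mix_density \<kappa> n \<rho> (y k))) \<partial>noise_law l n)
      = (\<Prod>k<l. \<integral>\<^sup>+y. ennreal (mix_density \<kappa> n \<rho> y) \<partial>cgauss_vec n)"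
    unfolding noise_law_def using mix_density_measurable[OF n \<kappa> \<rho>]
    by (intro product_nn_integral_prod) auto
  also have "\<dots> \<le> 1"
    using nn_integral_mix_density[OF n \<kappa> \<rho>] by (intro prod_le_1) auto
  finally show ?thesis .
qed

text \<open>Codeword \<open>j\<close> is decoded correctly with probability at most the common-law
  mass of \<open>B j\<close> inside \<open>low_info lam\<close>, plus \<open>1 - p\<close>. The
  first parts sum to at most \<open>exp lam\<close>, so
  \<open>M (1 - \<epsilon>) \<le> exp lam + M (1 - p)\<close>.\<close>

lemma code_size_bound:
  assumes code: "is_code \<kappa> l n M \<epsilon> \<rho> f g"
  shows "real M * (\<P>(W in noise_law l n. (\<Sum>k<l. S1 \<kappa> n \<rho> (W k)) \<le> lam) - \<epsilon>) \<le> exp lam"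
proof -
  let ?P = "axis_block_law \<kappa> l n \<rho>"
  let ?q = "\<lambda>y. \<Prod>k<l. ennreal (mix_density \<kappa> n \<rho> (y k))"
  define p where "p = measure ?P (low_info lam)"
  define A where "A = (\<lambda>j. {y \<in> space (block_space l n). g y = j})"
  interpret P: prob_space ?P by (rule prob_space_axis_block_law)
  have M: "M \<ge> 1" and g: "g \<in> block_space l n \<rightarrow>\<^sub>M count_space {1..M}"
    and err: "(\<Sum>j=1..M. \<P>(y in channel_law \<kappa> l n (f j). g y \<noteq> j)) / real M \<le> \<epsilon>"
    and f: "\<And>j. j \<in> {1..M} \<Longrightarrow> f j \<in> space (block_space l n)"
      "\<And>j k. j \<in> {1..M} \<Longrightarrow> k < l \<Longrightarrow> (vnorm n (f j k))\<^sup>2 = real n * \<rho>"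
    using code by (auto simp: is_code_def)
  have A [measurable]: "A j \<in> sets (block_space l n)" if "j \<in> {1..M}" for j
  proof -
    have "A j = g -` {j} \<inter> space (block_space l n)" by (auto simp: A_def)
    then show ?thesis using measurable_sets[OF g, of "{j}"] that by simp
  qed
  \<comment> \<open>One predicate bundles a region with its properties, so a single choice produces
    the whole family.\<close>
  define good where "good = (\<lambda>j B. B \<in> sets (block_space l n)
      \<and> 1 - \<P>(y in channel_law \<kappa> l n (f j). g y \<noteq> j) \<le> measure ?P (B \<inter> low_info lam) + (1 - p)
      \<and> (\<integral>\<^sup>+y. ?q y * indicator B y \<partial>noise_law l n) = (\<integral>\<^sup>+y. ?q y * indicator (A j) y \<partial>noise_law l n))"
  have ex: "\<exists>B. good j B"
    if j: "j \<in> {1..M}" for j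
  proof -
    from channel_law_rotate[OF f(1)[OF j] f(2)[OF j]]
    obtain T where T: "T \<in> block_space l n \<rightarrow>\<^sub>M block_space l n"
      and law: "channel_law \<kappa> l n (f j) = distr ?P (block_space l n) T"
      and inv: "distr (noise_law l n) (block_space l n) T = noise_law l n"
      and q: "\<And>y. y \<in> space (block_space l n) \<Longrightarrow> ?q (T y) = ?q y"
      by blast
    have T' [measurable]: "T \<in> ?P \<rightarrow>\<^sub>M block_space l n" "T \<in> noise_law l n \<rightarrow>\<^sub>M block_space l n"
      using T by simp_all
    define B where "B = T -` A j \<inter> space (block_space l n)"
    have B: "B \<in> sets (block_space l n)"
      unfolding B_def using T A[OF j] by (rule measurable_sets)
    interpret C: prob_space "channel_law \<kappa> l n (f j)"
      unfolding law by (rule P.prob_space_distr) simp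
    have "{y \<in> space (channel_law \<kappa> l n (f j)). g y \<noteq> j} = space (channel_law \<kappa> l n (f j)) - A j"
      by (auto simp: A_def law)
    then have "1 - \<P>(y in channel_law \<kappa> l n (f j). g y \<noteq> j) = measure (channel_law \<kappa> l n (f j)) (A j)"
      using A[OF j] C.prob_compl[of "A j"] by (simp add: law)
    also have "\<dots> = measure ?P B"
      unfolding law B_def using A[OF j] by (subst measure_distr) simp_all
    \<comment> \<open>Inside \<open>low_info lam\<close> the change of measure will apply; the
      complement costs \<open>1 - p\<close>, once per codeword.\<close>
    also have "\<dots> \<le> measure ?P ((B \<inter> low_info lam) \<union> (space ?P - low_info lam))"
      using B sets.sets_into_space[OF B] by (intro P.finite_measure_mono) auto
    also have "\<dots> \<le> measure ?P (B \<inter> low_info lam) + measure ?P (space ?P - low_info lam)"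
      using B by (intro measure_Un_le) auto
    also have "measure ?P (space ?P - low_info lam) = 1 - p"
      unfolding p_def by (intro P.prob_compl) simp
    finally have "1 - \<P>(y in channel_law \<kappa> l n (f j). g y \<noteq> j) \<le> measure ?P (B \<inter> low_info lam) + (1 - p)" .
    moreover have "(\<integral>\<^sup>+y. ?q y * indicator B y \<partial>noise_law l n) = (\<integral>\<^sup>+y. ?q y * indicator (A j) y \<partial>noise_law l n)"
    proof -
      have "(\<integral>\<^sup>+y. ?q y * indicator B y \<partial>noise_law l n) = (\<integral>\<^sup>+y. ?q (T y) * indicator (A j) (T y) \<partial>noise_law l n)"
        by (intro nn_integral_cong) (auto simp: q B_def indicator_def)
      also have "\<dots> = (\<integral>\<^sup>+y. ?q y * indicator (A j) y \<partial>distr (noise_law l n) (block_space l n) T)"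
        using A[OF j] by (intro nn_integral_distr[symmetric]) auto
      finally show ?thesis by (simp only: inv)
    qed
    ultimately have "good j B"
      unfolding good_def by (intro conjI B)
    then show ?thesis by (rule exI)
  qed
  then have "\<forall>j\<in>{1..M}. \<exists>B. good j B"
    by (intro ballI)
  from bchoice[OF this] obtain B where good: "\<forall>j\<in>{1..M}. good j (B j)" ..
  have B: "\<And>j. j \<in> {1..M} \<Longrightarrow> B j \<in> sets (block_space l n)"
      "\<And>j. j \<in> {1..M} \<Longrightarrow> 1 - \<P>(y in channel_law \<kappa> l n (f j). g y \<noteq> j) \<le> measure ?P (B j \<inter> low_info lam) + (1 - p)"
      "\<And>j. j \<in> {1..M} \<Longrightarrow> (\<integral>\<^sup>+y. ?q y * indicator (B j) y \<partial>noise_law l n) = (\<integral>\<^sup>+y. ?q y * indicator (A j) y \<partial>noise_law l n)"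
    using good[unfolded good_def] by (blast dest: bspec)+
  have "ennreal (\<Sum>j=1..M. measure ?P (B j \<inter> low_info lam)) = (\<Sum>j=1..M. emeasure ?P (B j \<inter> low_info lam))"
    by (simp add: P.emeasure_eq_measure sum_ennreal)
  also have "\<dots> \<le> (\<Sum>j=1..M. ennreal (exp lam) * (\<integral>\<^sup>+y. ?q y * indicator (A j) y \<partial>noise_law l n))"
    using emeasure_low_info_le[OF B(1)] B(3) by (intro sum_mono) auto
  also have "\<dots> = ennreal (exp lam) * (\<Sum>j=1..M. \<integral>\<^sup>+y. ?q y * indicator (A j) y \<partial>noise_law l n)"
    by (rule sum_distrib_left[symmetric])
  also have "(\<Sum>j=1..M. \<integral>\<^sup>+y. ?q y * indicator (A j) y \<partial>noise_law l n)
      = (\<integral>\<^sup>+y. (\<Sum>j=1..M. ?q y * indicator (A j) y) \<partial>noise_law l n)"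
    using A by (intro nn_integral_sum[symmetric]) auto
  also have "ennreal (exp lam) * (\<integral>\<^sup>+y. (\<Sum>j=1..M. ?q y * indicator (A j) y) \<partial>noise_law l n)
      \<le> ennreal (exp lam) * (\<integral>\<^sup>+y. ?q y \<partial>noise_law l n)"
  proof (intro mult_left_mono nn_integral_mono)
    fix y
    \<comment> \<open>At each output the decoder names a single message, so at most one indicator is
      1.\<close>
    have "(\<Sum>j=1..M. indicator (A j) y :: ennreal) \<le> (\<Sum>j=1..M. if g y = j then 1 else 0)"
      by (intro sum_mono) (auto simp: A_def indicator_def)
    also have "\<dots> \<le> 1" by simp
    finally have "(\<Sum>j=1..M. indicator (A j) y :: ennreal) \<le> 1" .
    from mult_left_mono[OF this, of "?q y"] show "(\<Sum>j=1..M. ?q y * indicator (A j) y) \<le> ?q y"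
      unfolding sum_distrib_left[symmetric] by simp
  qed simp
  also have "\<dots> \<le> ennreal (exp lam) * 1"
    by (intro mult_left_mono nn_integral_block_mix_density) simp
  finally have sum_le: "(\<Sum>j=1..M. measure ?P (B j \<inter> low_info lam)) \<le> exp lam"
    by simp
  have "(\<Sum>j=1..M. 1 - \<P>(y in channel_law \<kappa> l n (f j). g y \<noteq> j)) \<le> (\<Sum>j=1..M. measure ?P (B j \<inter> low_info lam) + (1 - p))"
    by (intro sum_mono B(2))
  then have "real M - (\<Sum>j=1..M. \<P>(y in channel_law \<kappa> l n (f j). g y \<noteq> j)) \<le> exp lam + real M * (1 - p)"
    using sum_le by (simp add: sum_subtractf sum.distrib)
  moreover have "(\<Sum>j=1..M. \<P>(y in channel_law \<kappa> l n (f j). g y \<noteq> j)) \<le> real M * \<epsilon>"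
    using err M by (simp add: divide_le_eq mult.commute)
  ultimately have "real M * (p - \<epsilon>) \<le> exp lam"
    by (simp add: algebra_simps)
  then show ?thesis by (simp only: p_def prob_low_info)
qed

end

theorem theorem5:
  fixes l nc :: nat and \<kappa> \<rho> \<epsilon> :: real
  assumes "l \<ge> 1" and "nc \<ge> 1" and "\<kappa> \<ge> 0" and "\<rho> > 0" and "0 < \<epsilon>" and "\<epsilon> < 1"
  shows "max_rate \<kappa> l nc \<epsilon> \<rho> \<le>
    (INF lam\<in>{0..}. ereal (1 / (real l * real nc * ln 2)) *
       (ereal lam - ext_ln (max 0 (\<P>(W in noise_law l nc. (\<Sum>k<l. S1 \<kappa> nc \<rho> (W k)) \<le> lam) - \<epsilon>))))"
  unfolding max_rate_def
proof (intro Sup_least INF_greatest)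
  fix R lam
  assume "R \<in> {ereal (log 2 (real M) / (real l * real nc)) | M. \<exists>f g. is_code \<kappa> l nc M \<epsilon> \<rho> f g}"
  then obtain M f g where R: "R = ereal (log 2 (real M) / (real l * real nc))"
      and code: "is_code \<kappa> l nc M \<epsilon> \<rho> f g" by blast
  have M: "M \<ge> 1" using code by (simp add: is_code_def)
  define d where "d = \<P>(W in noise_law l nc. (\<Sum>k<l. S1 \<kappa> nc \<rho> (W k)) \<le> lam) - \<epsilon>"
  have c: "1 / (real l * real nc * ln 2) > 0" using assms by simp
  show "R \<le> ereal (1 / (real l * real nc * ln 2)) *
       (ereal lam - ext_ln (max 0 (\<P>(W in noise_law l nc. (\<Sum>k<l. S1 \<kappa> nc \<rho> (W k)) \<le> lam) - \<epsilon>)))"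
  \<comment> \<open>For positive \<open>d\<close> the size bound is turned into logarithms, and the
    factor \<open>1 / ln 2\<close> passes to base 2. For \<open>d \<le> 0\<close> it says nothing
    about \<open>M\<close>, but then \<open>ext_ln 0\<close> makes the right-hand side
    infinite.\<close>
  proof (cases "d > 0")
    case True
    have "ln (real M * d) \<le> ln (exp lam)"
      using code_size_bound[OF assms(2-4) code, of lam] M True
      by (subst ln_le_cancel_iff) (auto simp: d_def)
    then have "ln (real M) \<le> lam - ln d"
      using M True by (simp add: ln_mult)
    then have "1 / (real l * real nc * ln 2) * ln (real M) \<le> 1 / (real l * real nc * ln 2) * (lam - ln d)"
      using c by (intro mult_left_mono) auto
    then show ?thesis
      using True unfolding d_def[symmetric]
      by (simp add: R log_def ext_ln_def max_def mult_ac)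
  next
    case False
    then have "ext_ln (max 0 d) = - \<infinity>" by (simp add: ext_ln_def)
    then show ?thesis using assms(1,2) unfolding d_def[symmetric] by simp
  qed
qed

end
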